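(* Let $S\subset\mathbb{R}^m$ and $T\subset\mathbb{R}^n$ be compact semialgebraic sets. If $T$ is locally $\mathcal{S}^\nu$ polyhedral for some integer $\nu\geq 1$, then $\mathcal{S}^\nu(S,T)$ is dense in $\mathcal{S}^0(S,T)$ (with the $\mathcal{S}^0$ topology).
   Context: A map between semialgebraic sets is semialgebraic if its graph is a semialgebraic set. For an integer $\nu\ge 0$ and an open semialgebraic set $U\subset\mathbb{R}^m$, $\mathcal{S}^\nu(U)$ is the set of semialgebraic functions $U\to\mathbb{R}$ of class $\mathcal{C}^\nu$. A function $f:S\to\mathbb{R}$ on a semialgebraic set $S\subset\mathbb{R}^m$ is $\mathcal{S}^\nu$ if there are an open semialgebraic neighborhood $U$ of $S$ in $\mathbb{R}^m$ and $F\in\mathcal{S}^\nu(U)$ with $F|_S=f$. A map $f=(f_1,\dots,f_n):S\to T\subset\mathbb{R}^n$ between semialgebraic sets is $\mathcal{S}^\nu$ if each $f_i:S\to\mathbb{R}$ is an $\mathcal{S}^\nu$ function; $\mathcal{S}^\nu(S,T)$ denotes the set of these maps. An $\mathcal{S}^\nu$ diffeomorphism is a bijective $\mathcal{S}^\nu$ map with $\mathcal{S}^\nu$ inverse. For $S$ compact, $\mathcal{S}^0(S,T)$ is the set of continuous semialgebraic maps $S\to T$, and the $\mathcal{S}^0$ topology on it is the topology of uniform convergence. A compact polyhedron of $\mathbb{R}^n$ is the realization $|K|$ of a finite simplicial complex $K$ of $\mathbb{R}^n$. A semialgebraic set $T\subset\mathbb{R}^n$ is locally $\mathcal{S}^\nu$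 polyhedral ($\nu\ge1$ an integer) if for each point $x\in T$ there exist two open semialgebraic neighborhoods $U_x$ and $V_x$ of $x$ in $\mathbb{R}^n$, an $\mathcal{S}^\nu$ diffeomorphism $\phi_x:U_x\to V_x$ and a compact polyhedron $Q$ of $\mathbb{R}^n$ such that $\phi_x(U_x\cap T)=V_x\cap Q$. *)

theory Defs
  imports "HOL-Analysis.Analysis"
begin

text \<open>The Boolean algebra of sets generated by the polynomial inequalities \<open>p x > 0\<close>. Equations
  need no separate rule, since \<open>{x. p x = 0}\<close> is the complement of \<open>{x. p x > 0} \<union> {x. - p x > 0}\<close>.\<close>

inductive semialgebraic :: "'a::euclidean_space set \<Rightarrow> bool" where
  pos: "real_polynomial_function p \<Longrightarrow> semialgebraic {x. p x > 0}"
| compl: "semialgebraic A \<Longrightarrow> semialgebraic (- A)"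
| union: "semialgebraic A \<Longrightarrow> semialgebraic B \<Longrightarrow> semialgebraic (A \<union> B)"

definition semialgebraic_map_on ::
  "'a::euclidean_space set \<Rightarrow> ('a \<Rightarrow> 'b::euclidean_space) \<Rightarrow> bool" where
  "semialgebraic_map_on S f \<longleftrightarrow> semialgebraic ((\<lambda>x. (x, f x)) ` S)"

text \<open>Class \<open>C\<^sup>k\<close>, meant only for open \<open>U\<close>: the iterated partial derivatives up to order \<open>k\<close> exist
  and are continuous on \<open>U\<close>. Values of \<open>F\<close> outside \<open>U\<close> are then irrelevant.\<close>

primrec C_class_on :: "nat \<Rightarrow> 'a::euclidean_space set \<Rightarrow> ('a \<Rightarrow> real) \<Rightarrow> bool" where
  "C_class_on 0 U F \<longleftrightarrow> continuous_on U F"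
| "C_class_on (Suc k) U F \<longleftrightarrow>
     (\<forall>x\<in>U. F differentiable (at x)) \<and>
     (\<forall>b\<in>Basis. C_class_on k U (\<lambda>x. frechet_derivative F (at x) b))"

definition Snu_open :: "nat \<Rightarrow> 'a::euclidean_space set \<Rightarrow> ('a \<Rightarrow> real) \<Rightarrow> bool" where
  "Snu_open \<nu> U F \<longleftrightarrow> semialgebraic_map_on U F \<and> C_class_on \<nu> U F"

definition Snu_function :: "nat \<Rightarrow> 'a::euclidean_space set \<Rightarrow> ('a \<Rightarrow> real) \<Rightarrow> bool" where
  "Snu_function \<nu> S f \<longleftrightarrow>
     (\<exists>U F. open U \<and> semialgebraic U \<and> S \<subseteq> U \<and> Snu_open \<nu> U F \<and> (\<forall>x\<in>S. F x = f x))"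

definition Snu_map ::
  "nat \<Rightarrow> (real^'m) set \<Rightarrow> (real^'n) set \<Rightarrow> (real^'m \<Rightarrow> real^'n) \<Rightarrow> bool" where
  "Snu_map \<nu> S T f \<longleftrightarrow> f \<in> S \<rightarrow> T \<and> (\<forall>i. Snu_function \<nu> S (\<lambda>x. f x $ i))"

definition Snu_diffeomorphism ::
  "nat \<Rightarrow> (real^'m) set \<Rightarrow> (real^'n) set \<Rightarrow> (real^'m \<Rightarrow> real^'n) \<Rightarrow> bool" where
  "Snu_diffeomorphism \<nu> S T f \<longleftrightarrow>
     bij_betw f S T \<and> Snu_map \<nu> S T f \<and> Snu_map \<nu> T S (inv_into S f)"

definition compact_polyhedron :: "'a::euclidean_space set \<Rightarrow> bool" where
  "compact_polyhedron Q \<longleftrightarrow> (\<exists>K. simplicial_complex K \<and> Q = \<Union>K)"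

definition locally_Snu_polyhedral :: "nat \<Rightarrow> (real^'n) set \<Rightarrow> bool" where
  "locally_Snu_polyhedral \<nu> T \<longleftrightarrow>
     (\<forall>x\<in>T. \<exists>U V \<phi> Q.
        open U \<and> semialgebraic U \<and> x \<in> U \<and>
        open V \<and> semialgebraic V \<and> x \<in> V \<and>
        Snu_diffeomorphism \<nu> U V \<phi> \<and> compact_polyhedron Q \<and>
        \<phi> ` (U \<inter> T) = V \<inter> Q)"

text \<open>Maps \<open>S \<rightarrow> T\<close> as elements of a function space are represented by total functions that are
  \<open>undefined\<close> outside \<open>S\<close>, as in \<^const>\<open>funspace\<close>.\<close>

definition Snu_maps ::
  "nat \<Rightarrow> (real^'m) set \<Rightarrow> (real^'n) set \<Rightarrow> (real^'m \<Rightarrow> real^'n) set" where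
  "Snu_maps \<nu> S T = {f \<in> extensional S. Snu_map \<nu> S T f}"

text \<open>The next two definitions are meant only for compact \<open>S\<close>; then continuous maps on \<open>S\<close> are
  bounded, so the carrier of \<open>S0_topology S T\<close> is all of \<open>S0_maps S T\<close>.\<close>

definition S0_maps :: "(real^'m) set \<Rightarrow> (real^'n) set \<Rightarrow> (real^'m \<Rightarrow> real^'n) set" where
  "S0_maps S T = {f \<in> S \<rightarrow>\<^sub>E T. continuous_on S f \<and> semialgebraic_map_on S f}"

definition S0_topology :: "(real^'m) set \<Rightarrow> (real^'n) set \<Rightarrow> (real^'m \<Rightarrow> real^'n) topology" where
  "S0_topology S T = mtopology_of (submetric (funspace S euclidean_metric) (S0_maps S T))"

end

theory Submission
  imports Defs "HOL-Computational_Algebra.Polynomial"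
begin

text \<open>
  It suffices to find, for every \<open>\<epsilon> > 0\<close>, an \<open>\<S>\<^sup>\<nu>\<close> map from a neighbourhood of \<open>T\<close> into \<open>T\<close> that is
  \<open>\<epsilon>\<close>-close to the identity: composed with a polynomial approximation of \<open>f\<close> it gives the required
  approximation of \<open>f\<close>; no triangulation of \<open>S\<close> or \<open>T\<close> is needed. For a finite union \<open>Q\<close> of compact convex
  sets such a map is \<open>\<rho> z = (\<Sum>y. \<beta>\<^sub>y z *\<^sub>R y) / (\<Sum>y. \<beta>\<^sub>y z)\<close>, where finitely many points \<open>y \<in> Q\<close> carry bumps
  \<open>\<beta>\<^sub>y\<close> supported in small balls that meet only those cells that contain \<open>y\<close>. If \<open>z\<close> lies in a cell then so
  does the whole segment from \<open>z\<close> to \<open>\<rho> z\<close>; hence, in a chart, \<open>y + \<theta> y *\<^sub>R (\<rho> y - y)\<close> with a cutoff \<open>\<theta>\<close>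
  still preserves \<open>Q\<close>. These local maps preserve \<open>T\<close>, extend by the identity, and can be composed over a
  finite family of charts. Semialgebraicity of compositions is the Tarski-Seidenberg theorem.
\<close>

section \<open>Elimination of a real quantifier\<close>

text \<open>An exact retraction is out of reach: the image of a C^1 retraction of an open set is a
  C^1 manifold, which a set with corners or branching is not. Hence a map into \<open>T\<close> that
  only stays near the identity.

  Local maps cannot be averaged by a partition of unity, since \<open>T\<close> is not convex; they
  are composed instead. A later map must not undo what an earlier one achieved, so each has to
  preserve all of \<open>T\<close>, including the zone where its cutoff lies strictly between 0 and
  1. This is why whole segments, and not just the points \<rho> z, have to remain in the polyhedron.

  Infinitely differentiable semialgebraic functions on open sets are analytic, so a nonzero one on
  the whole space never has compact support. Bumps and cutoffs therefore exist only for a finite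
  order \<nu>, and are built from powers of the positive part.

  Composition, image and domain of semialgebraic maps each conceal an existential quantifier over a
  real vector, whereas the definition of \<open>semialgebraic\<close> is quantifier-free;
  eliminating one real quantifier is what bridges this.\<close>

text \<open>Parameters are environments \<open>nat \<Rightarrow> real\<close>, and \<open>case_nat t e\<close> pushes a new variable in front of \<open>e\<close>:
  the induction behind the elimination nests quantifiers, so the parameter space has to be one
  fixed type.\<close>

inductive env_poly :: "((nat \<Rightarrow> real) \<Rightarrow> real) \<Rightarrow> bool" where
  const: "env_poly (\<lambda>e. c)"
| var: "env_poly (\<lambda>e. e i)"
| add: "env_poly f \<Longrightarrow> env_poly g \<Longrightarrow> env_poly (\<lambda>e. f e + g e)"
| mult: "env_poly f \<Longrightarrow> env_poly g \<Longrightarrow> env_poly (\<lambda>e. f e * g e)"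

inductive env_sa :: "((nat \<Rightarrow> real) \<Rightarrow> bool) \<Rightarrow> bool" where
  pos: "env_poly f \<Longrightarrow> env_sa (\<lambda>e. f e > 0)"
| neg: "env_sa P \<Longrightarrow> env_sa (\<lambda>e. \<not> P e)"
| disj: "env_sa P \<Longrightarrow> env_sa Q \<Longrightarrow> env_sa (\<lambda>e. P e \<or> Q e)"

lemma env_poly_uminus: "env_poly f \<Longrightarrow> env_poly (\<lambda>e. - f e)"
  using env_poly.mult[OF env_poly.const[of "-1"]] by simp

lemma env_poly_diff: "env_poly f \<Longrightarrow> env_poly g \<Longrightarrow> env_poly (\<lambda>e. f e - g e)"
  using env_poly.add[OF _ env_poly_uminus] by simp

lemma env_poly_power: "env_poly f \<Longrightarrow> env_poly (\<lambda>e. f e ^ n)"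
  by (induction n) (auto intro: env_poly.intros)

lemma env_poly_sum: "(\<And>i. i \<in> A \<Longrightarrow> env_poly (f i)) \<Longrightarrow> env_poly (\<lambda>e. \<Sum>i\<in>A. f i e)"
  by (induction A rule: infinite_finite_induct) (auto intro: env_poly.intros)

lemma env_poly_divide: "env_poly f \<Longrightarrow> env_poly (\<lambda>e. f e / c)"
  using env_poly.mult[OF _ env_poly.const[of "inverse c"]] by (simp add: field_simps)

lemmas env_poly_rules = env_poly.intros env_poly_uminus env_poly_diff env_poly_power env_poly_sum env_poly_divide

lemma env_poly_subst: "env_poly f \<Longrightarrow> (\<And>i. env_poly (g i)) \<Longrightarrow> env_poly (\<lambda>e. f (\<lambda>i. g i e))"
  by (induction rule: env_poly.induct) (auto intro: env_poly.intros)

lemma env_sa_subst: "env_sa P \<Longrightarrow> (\<And>i. env_poly (g i)) \<Longrightarrow> env_sa (\<lambda>e. P (\<lambda>i. g i e))"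
proof (induction rule: env_sa.induct)
  case (pos f)
  then show ?case using env_sa.pos[OF env_poly_subst] by blast
qed (auto intro: env_sa.intros)

lemma env_sa_conj: "env_sa P \<Longrightarrow> env_sa Q \<Longrightarrow> env_sa (\<lambda>e. P e \<and> Q e)"
  using env_sa.neg[OF env_sa.disj[OF env_sa.neg env_sa.neg]] by simp

lemma env_sa_const: "env_sa (\<lambda>e. c)"
proof (cases c)
  case True then show ?thesis using env_sa.pos[OF env_poly.const[of 1]] by simp
next
  case False then show ?thesis using env_sa.pos[OF env_poly.const[of 0]] by simp
qed

lemma env_sa_less: "env_poly f \<Longrightarrow> env_poly g \<Longrightarrow> env_sa (\<lambda>e. f e < g e)"
  using env_sa.pos[OF env_poly_diff, of g f] by simp

lemma env_sa_le: "env_poly f \<Longrightarrow> env_poly g \<Longrightarrow> env_sa (\<lambda>e. f e \<le> g e)"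
  using env_sa.neg[OF env_sa_less[of g f]] by (simp add: not_less)

lemma env_sa_eq: "env_poly f \<Longrightarrow> env_poly g \<Longrightarrow> env_sa (\<lambda>e. f e = g e)"
  using env_sa_conj[OF env_sa_le env_sa_le, of f g g f] by (simp add: eq_iff)

lemma env_sa_bex: "finite A \<Longrightarrow> (\<And>x. x \<in> A \<Longrightarrow> env_sa (P x)) \<Longrightarrow> env_sa (\<lambda>e. \<exists>x\<in>A. P x e)"
  by (induction rule: finite_induct) (auto intro: env_sa.intros env_sa_const)

lemma env_sa_ball: "finite A \<Longrightarrow> (\<And>x. x \<in> A \<Longrightarrow> env_sa (P x)) \<Longrightarrow> env_sa (\<lambda>e. \<forall>x\<in>A. P x e)"
  using env_sa.neg[OF env_sa_bex[of A "\<lambda>x e. \<not> P x e"]] by (auto intro: env_sa.neg)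

lemmas env_sa_rules = env_sa.neg env_sa.disj env_sa_conj env_sa_const env_sa_less env_sa_le env_sa_eq env_sa_bex env_sa_ball

text \<open>Univariate polynomials with coefficients polynomial in the parameters. The number
  \<open>n\<close> bounds a formal degree, uniformly in \<open>e\<close>; for particular parameters
  the leading coefficient may vanish, so the actual degree may drop.\<close>

definition poly_fam :: "nat \<Rightarrow> ((nat \<Rightarrow> real) \<Rightarrow> real poly) \<Rightarrow> bool" where
  "poly_fam n p \<longleftrightarrow> (\<forall>i. env_poly (\<lambda>e. coeff (p e) i)) \<and> (\<forall>e. degree (p e) \<le> n)"

lemma poly_fam_coeff: "poly_fam n p \<Longrightarrow> env_poly (\<lambda>e. coeff (p e) i)"
  by (simp add: poly_fam_def)

lemma poly_fam_degree: "poly_fam n p \<Longrightarrow> degree (p e) \<le> n"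
  by (simp add: poly_fam_def)

lemma poly_fam_mono: "poly_fam n p \<Longrightarrow> n \<le> m \<Longrightarrow> poly_fam m p"
  unfolding poly_fam_def using le_trans by blast

lemma poly_bounded_degree: "degree p \<le> n \<Longrightarrow> poly p x = (\<Sum>i\<le>n. coeff p i * x ^ i)"
  for p :: "real poly"
  unfolding poly_altdef by (rule sum.mono_neutral_left) (auto simp: coeff_eq_0)

lemma env_poly_poly: "poly_fam n p \<Longrightarrow> env_poly f \<Longrightarrow> env_poly (\<lambda>e. poly (p e) (f e))"
  by (subst poly_bounded_degree[of _ n]) (simp_all add: poly_fam_def env_poly_rules)

lemma poly_fam_subst: "poly_fam n p \<Longrightarrow> (\<And>i. env_poly (g i)) \<Longrightarrow> poly_fam n (\<lambda>e. p (\<lambda>i. g i e))"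
  unfolding poly_fam_def by (auto intro: env_poly_subst[where f = "\<lambda>e. coeff (p e) i" for i])

lemma poly_fam_add: "poly_fam n p \<Longrightarrow> poly_fam m q \<Longrightarrow> poly_fam (max n m) (\<lambda>e. p e + q e)"
  by (auto simp: poly_fam_def intro!: env_poly_rules degree_add_le intro: max.coboundedI1 max.coboundedI2)

lemma poly_fam_mult: "poly_fam n p \<Longrightarrow> poly_fam m q \<Longrightarrow> poly_fam (n + m) (\<lambda>e. p e * q e)"
  unfolding poly_fam_def coeff_mult
  by (intro conjI allI env_poly_rules order_trans[OF degree_mult_le] add_mono) auto

lemma poly_fam_pderiv: "poly_fam (Suc n) p \<Longrightarrow> poly_fam n (\<lambda>e. pderiv (p e))"
  unfolding poly_fam_def coeff_pderiv degree_pderiv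
  by (intro conjI allI env_poly_rules) (auto simp: le_diff_conv)

lemma env_poly_family:
  assumes "env_poly f"
  shows "\<exists>q n. poly_fam n q \<and> (\<forall>e t. f (case_nat t e) = poly (q e) t)"
  using assms
proof (induction rule: env_poly.induct)
  case (const c)
  have "poly_fam 0 (\<lambda>e. [:c:])" by (auto simp: poly_fam_def intro!: env_poly_rules)
  then show ?case by (intro exI[of _ "\<lambda>e. [:c:]"] exI[of _ 0]) auto
next
  case (var i)
  show ?case
  proof (cases i)
    case 0
    have "poly_fam 1 (\<lambda>e. [:0, 1:])" by (auto simp: poly_fam_def intro!: env_poly_rules)
    then show ?thesis using 0 by (intro exI[of _ "\<lambda>e. [:0, 1:]"] exI[of _ 1]) auto
  next
    case (Suc k)
    have "env_poly (\<lambda>e. coeff [:e k:] i)" for i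
      by (cases i) (auto intro: env_poly_rules)
    then have "poly_fam 0 (\<lambda>e. [:e k:])" by (auto simp: poly_fam_def)
    then show ?thesis using Suc by (intro exI[of _ "\<lambda>e. [:e k:]"] exI[of _ 0]) auto
  qed
next
  case (add f g)
  then obtain p n q m where *: "poly_fam n p" "poly_fam m q" "\<forall>e t. f (case_nat t e) = poly (p e) t"
    "\<forall>e t. g (case_nat t e) = poly (q e) t" by blast
  then show ?case using poly_fam_add[OF *(1,2)] by (intro exI[of _ "\<lambda>e. p e + q e"] exI) auto
next
  case (mult f g)
  then obtain p n q m where *: "poly_fam n p" "poly_fam m q" "\<forall>e t. f (case_nat t e) = poly (p e) t"
    "\<forall>e t. g (case_nat t e) = poly (q e) t" by blast
  then show ?case using poly_fam_mult[OF *(1,2)] by (intro exI[of _ "\<lambda>e. p e * q e"] exI) auto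
qed

text \<open>Pseudo-division, where the even power of the leading coefficient preserves the sign.\<close>

lemma poly_fam_reduce:
  assumes p: "poly_fam d p" and "d > 0" and q: "poly_fam n q"
  shows "\<exists>r. poly_fam (d - 1) r \<and> (\<forall>e t. coeff (p e) d \<noteq> 0 \<and> poly (p e) t = 0 \<longrightarrow>
    sgn (poly (r e) t) = sgn (poly (q e) t))"
  using q
proof (induction n arbitrary: q)
  case 0
  then show ?case using poly_fam_mono by blast
next
  case (Suc n)
  show ?case
  proof (cases "Suc n < d")
    case True
    then have "poly_fam (d - 1) q" using poly_fam_mono[OF Suc.prems, of "d - 1"] by auto
    then show ?thesis by blast
  next
    case False
    let ?l = "\<lambda>e. coeff (p e) d"
    \<comment> \<open>One division step with denominators cleared. In degree \<open>Suc n\<close>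
      the two terms cancel; at a root of \<open>p\<close> the second one vanishes and
      \<open>q\<close> times a positive square remains.\<close>
    let ?q = "\<lambda>e. smult ((?l e)^2) (q e) + - (smult (?l e * coeff (q e) (Suc n)) (monom 1 (Suc n - d) * p e))"
    have pf: "env_poly (\<lambda>e. coeff (?q e) i)" for i
      using poly_fam_coeff[OF Suc.prems] poly_fam_coeff[OF p]
      by (cases "i < Suc n - d") (auto simp: coeff_monom_mult intro!: env_poly_rules)
    have deg: "degree (?q e) \<le> n" for e
    proof (rule degree_le, intro allI impI)
      fix i assume "n < i"
      show "coeff (?q e) i = 0"
      proof (cases "i = Suc n")
        case True
        then show ?thesis using False by (simp add: coeff_monom_mult power2_eq_square)
      next
        case False2: False
        then have "i > Suc n" using \<open>n < i\<close> by auto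
        then have "coeff (q e) i = 0" "coeff (p e) (i - (Suc n - d)) = 0"
          using poly_fam_degree[OF Suc.prems, of e] poly_fam_degree[OF p, of e] False
          by (auto intro!: coeff_eq_0)
        then show ?thesis by (auto simp: coeff_monom_mult)
      qed
    qed
    from pf deg have "poly_fam n ?q" by (simp add: poly_fam_def)
    from Suc.IH[OF this] obtain r where r: "poly_fam (d - 1) r"
      "\<And>e t. coeff (p e) d \<noteq> 0 \<and> poly (p e) t = 0 \<longrightarrow> sgn (poly (r e) t) = sgn (poly (?q e) t)"
      by blast
    have "sgn (poly (?q e) t) = sgn (poly (q e) t)" if "coeff (p e) d \<noteq> 0" "poly (p e) t = 0" for e t
    proof -
      have "sgn ((coeff (p e) d)\<^sup>2) = 1" using that by (intro sgn_pos) simp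
      then show ?thesis using that by (simp add: sgn_mult)
    qed
    with r show ?thesis by metis
  qed
qed

section \<open>Sign conditions of finitely many polynomials in one variable\<close>

definition sign_determined ::
  "((nat \<Rightarrow> real) \<Rightarrow> real poly) set \<Rightarrow> ((nat \<Rightarrow> real) \<Rightarrow> bool) \<Rightarrow> bool" where
  "sign_determined Q P \<longleftrightarrow> (\<forall>e t t'. (\<forall>q\<in>Q. sgn (poly (q e) t) = sgn (poly (q e) t')) \<longrightarrow>
     P (case_nat t e) = P (case_nat t' e))"

lemma sign_determinedD:
  "sign_determined Q P \<Longrightarrow> (\<And>q. q \<in> Q \<Longrightarrow> sgn (poly (q e) t) = sgn (poly (q e) t')) \<Longrightarrow>
     P (case_nat t e) \<Longrightarrow> P (case_nat t' e)"
  unfolding sign_determined_def by blast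

lemma sign_determined_neg: "sign_determined Q P \<Longrightarrow> sign_determined Q (\<lambda>e. \<not> P e)"
  unfolding sign_determined_def by meson

lemma sign_determined_disj:
  "sign_determined Q P \<Longrightarrow> sign_determined Q' P' \<Longrightarrow> sign_determined (Q \<union> Q') (\<lambda>e. P e \<or> P' e)"
  unfolding sign_determined_def by (metis UnCI)

lemma sign_determined_pos:
  assumes "\<And>e t. f (case_nat t e) = poly (q e) t"
  shows "sign_determined {q} (\<lambda>e. f e > 0)"
  unfolding sign_determined_def assms by (auto simp: sgn_if split: if_splits)

text \<open>Each atom \<open>f e > 0\<close>, read as a condition on variable 0, contributes one
  polynomial. Finitely many polynomials cut the line into finitely many points and intervals of
  constant sign, so a quantifier over the reals becomes a search among sample points.\<close>

lemma env_sa_signs: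
  assumes "env_sa P"
  shows "\<exists>Q. finite Q \<and> (\<forall>q\<in>Q. \<exists>n. poly_fam n q) \<and> sign_determined Q P"
  using assms
proof (induction rule: env_sa.induct)
  case (pos f)
  obtain q n where q: "poly_fam n q" "\<And>e t. f (case_nat t e) = poly (q e) t"
    using env_poly_family[OF pos] by blast
  show ?case
    by (rule exI[of _ "{q}"]) (use q(1) sign_determined_pos[of f q, OF q(2)] in blast)
next
  case (neg P)
  then show ?case using sign_determined_neg by blast
next
  case (disj P1 P2)
  then obtain Q1 Q2 where *: "finite Q1" "\<forall>q\<in>Q1. \<exists>n. poly_fam n q" "sign_determined Q1 P1"
    "finite Q2" "\<forall>q\<in>Q2. \<exists>n. poly_fam n q" "sign_determined Q2 P2" by blast
  show ?case
    by (rule exI[of _ "Q1 \<union> Q2"]) (use * sign_determined_disj[OF *(3,6)] in blast)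
qed

text \<open>Every atom is replaced by the atom of its remainder modulo \<open>p\<close>. The new
  predicate agrees with \<open>P\<close> at the roots of \<open>p\<close> only, but as it involves
  smaller degrees and is again \<open>env_sa\<close>, it can be evaluated at another point with the
  same signs.\<close>

lemma env_sa_signs_reduced:
  assumes "env_sa P" and p: "poly_fam d p" and d: "d > 0"
  shows "\<exists>Q P'. finite Q \<and> (\<forall>q\<in>Q. poly_fam (d - 1) q) \<and> env_sa P' \<and> sign_determined Q P' \<and>
    (\<forall>e t. coeff (p e) d \<noteq> 0 \<and> poly (p e) t = 0 \<longrightarrow> P' (case_nat t e) = P (case_nat t e))"
  using assms(1)
proof (induction rule: env_sa.induct)
  case (pos f)
  obtain q n where q: "poly_fam n q" "\<And>e t. f (case_nat t e) = poly (q e) t"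
    using env_poly_family[OF pos] by blast
  obtain r where r: "poly_fam (d - 1) r" "\<And>e t. coeff (p e) d \<noteq> 0 \<and> poly (p e) t = 0 \<Longrightarrow>
    sgn (poly (r e) t) = sgn (poly (q e) t)"
    using poly_fam_reduce[OF p d q(1)] by blast
  \<comment> \<open>Variable 0 is the point of evaluation and the shifted environment carries the
    parameters, so that the remainder becomes a polynomial in the extended environment.\<close>
  let ?f = "\<lambda>e. poly (r (\<lambda>i. e (Suc i))) (e 0)"
  have P: "env_sa (\<lambda>e. ?f e > 0)"
    by (intro env_sa.pos env_poly_poly[OF poly_fam_subst[OF r(1)]] env_poly_rules)
  have sd: "sign_determined {r} (\<lambda>e. ?f e > 0)"
    by (rule sign_determined_pos) simp
  have eq: "(?f (case_nat t e) > 0) = (f (case_nat t e) > 0)"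
    if "coeff (p e) d \<noteq> 0 \<and> poly (p e) t = 0" for e t
    using r(2)[OF that] q(2)[of t e] by (auto simp: sgn_if split: if_splits)
  show ?case
    by (rule exI[of _ "{r}"], rule exI[of _ "\<lambda>e. ?f e > 0"]) (use r(1) P sd eq in blast)
next
  case (neg P)
  then obtain Q P' where *: "finite Q" "\<forall>q\<in>Q. poly_fam (d - 1) q" "env_sa P'" "sign_determined Q P'"
    "\<forall>e t. coeff (p e) d \<noteq> 0 \<and> poly (p e) t = 0 \<longrightarrow> P' (case_nat t e) = P (case_nat t e)" by blast
  show ?case
    by (rule exI[of _ Q], rule exI[of _ "\<lambda>e. \<not> P' e"])
       (use * sign_determined_neg[OF *(4)] env_sa.neg[OF *(3)] in blast)
next
  case (disj P1 P2)
  obtain Q1 P1' where 1: "finite Q1" "\<forall>q\<in>Q1. poly_fam (d - 1) q" "env_sa P1'" "sign_determined Q1 P1'"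
    "\<forall>e t. coeff (p e) d \<noteq> 0 \<and> poly (p e) t = 0 \<longrightarrow> P1' (case_nat t e) = P1 (case_nat t e)"
    using disj.IH(1) by blast
  obtain Q2 P2' where 2: "finite Q2" "\<forall>q\<in>Q2. poly_fam (d - 1) q" "env_sa P2'" "sign_determined Q2 P2'"
    "\<forall>e t. coeff (p e) d \<noteq> 0 \<and> poly (p e) t = 0 \<longrightarrow> P2' (case_nat t e) = P2 (case_nat t e)"
    using disj.IH(2) by blast
  show ?case
    by (rule exI[of _ "Q1 \<union> Q2"], rule exI[of _ "\<lambda>e. P1' e \<or> P2' e"])
       (use 1 2 sign_determined_disj[OF 1(4) 2(4)] env_sa.disj[OF 1(3) 2(3)] in blast)
qed

text \<open>A sign change would force a root by the intermediate value theorem. The hypothesis is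
  conditional on \<open>q \<noteq> 0\<close> because the zero polynomial has roots everywhere and
  still a constant sign.\<close>

lemma poly_sgn_constant:
  fixes q :: "real poly"
  assumes "\<And>z. q \<noteq> 0 \<Longrightarrow> min t t' \<le> z \<Longrightarrow> z \<le> max t t' \<Longrightarrow> poly q z \<noteq> 0"
  shows "sgn (poly q t) = sgn (poly q t')"
proof (cases "q = 0 \<or> t = t'")
  case False
  have "\<not> poly q t * poly q t' < 0"
  proof
    assume neg: "poly q t * poly q t' < 0"
    have "\<exists>z. min t t' < z \<and> z < max t t' \<and> poly q z = 0"
    proof (cases "t < t'")
      case True
      then show ?thesis using poly_IVT[OF True neg] by auto
    next
      case f: False
      then have "t' < t" using False by auto
      then show ?thesis using poly_IVT[of t' t q] neg by (auto simp: mult.commute)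
    qed
    with assms False show False by force
  qed
  moreover have "poly q t \<noteq> 0" "poly q t' \<noteq> 0" using assms False by auto
  ultimately show ?thesis by (auto simp: sgn_if mult_less_0_iff)
qed auto

text \<open>A Cauchy bound on the roots, with squares in place of absolute values so that numerator
  and denominator are polynomial in the coefficients. The bound and its negative are then roots of
  linear polynomials whose coefficients are polynomial in the parameters.\<close>

lemma poly_root_bound:
  fixes p :: "real poly"
  assumes deg: "degree p \<le> Suc n" and c: "coeff p (Suc n) \<noteq> 0" and t: "poly p t = 0"
  shows "\<bar>t\<bar> < (\<Sum>i\<le>n. (coeff p (Suc n))\<^sup>2 + (coeff p i)\<^sup>2) / (coeff p (Suc n))\<^sup>2"
proof (rule ccontr)
  define c where "c = coeff p (Suc n)"
  define x where "x = (\<lambda>i. coeff p i / c)"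
  have c0: "c \<noteq> 0" using assms by (simp add: c_def)
  have eq: "(\<Sum>i\<le>n. c\<^sup>2 + (coeff p i)\<^sup>2) / c\<^sup>2 = (\<Sum>i\<le>n. 1 + (x i)\<^sup>2)"
    using c0 by (simp add: sum_divide_distrib x_def add_divide_distrib power_divide)
  assume "\<not> ?thesis"
  then have B: "(\<Sum>i\<le>n. 1 + (x i)\<^sup>2) \<le> \<bar>t\<bar>" using eq by (simp add: c_def)
  have "1 \<le> (\<Sum>i\<le>n. 1 + (x i)\<^sup>2)"
    using member_le_sum[of 0 "{..n}" "\<lambda>i. 1 + (x i)\<^sup>2"] by (auto simp: add_nonneg_nonneg intro: order_trans[rotated])
  then have t1: "1 \<le> \<bar>t\<bar>" using B by simp
  have "0 = (\<Sum>i\<le>n. coeff p i * t ^ i) + c * t ^ Suc n"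
    using t poly_bounded_degree[OF deg, of t] by (simp add: c_def)
  then have "t ^ Suc n = - (\<Sum>i\<le>n. coeff p i * t ^ i) / c" using c0 by (simp add: field_simps)
  also have "\<dots> = - (\<Sum>i\<le>n. x i * t ^ i)" by (simp add: x_def sum_divide_distrib)
  finally have "\<bar>t\<bar> ^ Suc n = \<bar>\<Sum>i\<le>n. x i * t ^ i\<bar>" by (metis abs_minus_cancel power_abs)
  also have "\<dots> \<le> (\<Sum>i\<le>n. \<bar>x i\<bar> * \<bar>t\<bar> ^ i)"
    using sum_abs[of "\<lambda>i. x i * t ^ i" "{..n}"] by (simp add: abs_mult power_abs)
  also have "\<dots> \<le> (\<Sum>i\<le>n. \<bar>x i\<bar> * \<bar>t\<bar> ^ n)"
    using t1 by (intro sum_mono mult_left_mono power_increasing) auto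
  also have "\<dots> < (\<Sum>i\<le>n. (1 + (x i)\<^sup>2) * \<bar>t\<bar> ^ n)"
  proof (rule sum_strict_mono)
    fix i
    \<comment> \<open>Completing the square in 1 + x^2 - |x|; it justifies replacing |x| by 1 + x^2
      in the Cauchy bound.\<close>
    have "0 < (\<bar>x i\<bar> - 1/2)\<^sup>2 + 3/4" by (simp add: add_nonneg_pos)
    then have "\<bar>x i\<bar> < 1 + (x i)\<^sup>2" by (simp add: power2_eq_square algebra_simps)
    then show "\<bar>x i\<bar> * \<bar>t\<bar> ^ n < (1 + (x i)\<^sup>2) * \<bar>t\<bar> ^ n"
      using t1 by (intro mult_strict_right_mono) auto
  qed auto
  also have "\<dots> = (\<Sum>i\<le>n. 1 + (x i)\<^sup>2) * \<bar>t\<bar> ^ n" by (simp add: sum_distrib_right)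
  also have "\<dots> \<le> \<bar>t\<bar> * \<bar>t\<bar> ^ n" using B by (intro mult_right_mono) auto
  finally show False by simp
qed

lemma env_poly_case_nat:
  "env_poly f \<Longrightarrow> (\<And>i. env_poly (\<lambda>e. g e i)) \<Longrightarrow> env_poly (\<lambda>e. case_nat (f e) (g e) i)"
  by (cases i) auto

lemma env_sa_inst: "env_sa P \<Longrightarrow> env_poly f \<Longrightarrow> env_sa (\<lambda>e. P (case_nat (f e) e))"
  by (rule env_sa_subst[of P "\<lambda>i e. case_nat (f e) e i"]) (auto intro: env_poly_case_nat env_poly.intros)

lemma finite_roots_family:
  fixes Q :: "('e \<Rightarrow> real poly) set"
  assumes "finite Q"
  shows "finite {z. \<exists>q\<in>Q. q e \<noteq> 0 \<and> poly (q e) z = 0}"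
proof -
  have "{z. \<exists>q\<in>Q. q e \<noteq> 0 \<and> poly (q e) z = 0} = (\<Union>q\<in>{q\<in>Q. q e \<noteq> 0}. {z. poly (q e) z = 0})"
    by auto
  then show ?thesis using assms by (auto intro: poly_roots_finite)
qed

text \<open>Induction on the degree. Modulo \<open>p\<close>, the predicate only depends on the signs of polynomials of
  smaller degree; let \<open>Q2\<close> consist of these, of \<open>p'\<close>, and of two linear polynomials whose roots enclose the
  roots of \<open>p\<close>. A root of \<open>p\<close> is either a root of a member of \<open>Q2\<close> (\<open>C1\<close>), or lies between two consecutive
  roots \<open>a < b\<close> of members of \<open>Q2\<close> (\<open>C2\<close>); in the second case \<open>p\<close> is monotone on \<open>[a, b]\<close>, so that the
  existence of the root means \<open>p a * p b < 0\<close>, and the signs at the root are those at the midpoint.\<close>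

lemma env_sa_ex_root:
  assumes "poly_fam d p" and "env_sa (\<lambda>e. R (\<lambda>i. e (Suc i)) (e 0))"
  shows "env_sa (\<lambda>e. p e \<noteq> 0 \<and> (\<exists>t. poly (p e) t = 0 \<and> R e t))"
  using assms
proof (induction d arbitrary: p R)
  case 0
  have "\<not> (p e \<noteq> 0 \<and> (\<exists>t. poly (p e) t = 0 \<and> R e t))" for e
  proof -
    have "degree (p e) = 0" using 0(1) by (simp add: poly_fam_def)
    then obtain c where "p e = [:c:]" by (meson degree_eq_zeroE)
    then show ?thesis by auto
  qed
  then have "(\<lambda>e. p e \<noteq> 0 \<and> (\<exists>t. poly (p e) t = 0 \<and> R e t)) = (\<lambda>e. False)" by blast
  then show ?case using env_sa_const[of False] by (simp only:)
next
  case (Suc n)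
  note p = Suc.prems(1) and R = Suc.prems(2)
  define c where "c = (\<lambda>e. coeff (p e) (Suc n))"
  have c: "env_poly c" unfolding c_def by (rule poly_fam_coeff[OF p])
  \<comment> \<open>Where the leading coefficient vanishes, \<open>p\<close> equals its truncation,
    a family of formal degree \<open>n\<close> to which the induction hypothesis applies.\<close>
  have trunc: "env_sa (\<lambda>e. p e - monom (c e) (Suc n) \<noteq> 0 \<and>
    (\<exists>t. poly (p e - monom (c e) (Suc n)) t = 0 \<and> R e t))"
  proof (rule Suc.IH[OF _ R])
    have "degree (p e - monom (c e) (Suc n)) \<le> n" for e
      using poly_fam_degree[OF p, of e]
      by (intro degree_le) (auto simp: c_def coeff_eq_0 Suc_lessI)
    moreover have "env_poly (\<lambda>e. coeff (p e - monom (c e) (Suc n)) i)" for i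
      using poly_fam_coeff[OF p] c by (cases "i = Suc n") (auto intro!: env_poly_rules)
    ultimately show "poly_fam n (\<lambda>e. p e - monom (c e) (Suc n))" by (simp add: poly_fam_def)
  qed
  obtain Q P' where Q: "finite Q" "\<And>q. q \<in> Q \<Longrightarrow> poly_fam n q" and P': "env_sa P'" "sign_determined Q P'"
    and eq: "\<And>e t. c e \<noteq> 0 \<Longrightarrow> poly (p e) t = 0 \<Longrightarrow> P' (case_nat t e) = R e t"
    using env_sa_signs_reduced[OF R p] by (auto simp: c_def)
  have main: "env_sa (\<lambda>e. c e \<noteq> 0 \<and> (\<exists>t. poly (p e) t = 0 \<and> R e t))"
  proof (cases "n = 0")
    \<comment> \<open>The enclosing linear polynomials used below would exceed the degree bound when
      \<open>n = 0\<close>. Here, however, all members of \<open>Q\<close> are constant in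
      \<open>t\<close>, so \<open>P'\<close> ignores \<open>t\<close> and the sample point 0
      decides.\<close>
    case True
    have lin: "\<exists>t. poly (p e) t = 0" if "c e \<noteq> 0" for e
    proof -
      have "poly (p e) t = coeff (p e) 0 + c e * t" for t
        using poly_bounded_degree[OF poly_fam_degree[OF p, of e], of t] True by (simp add: c_def)
      then have "poly (p e) (- coeff (p e) 0 / c e) = 0" using that by simp
      then show ?thesis by blast
    qed
    have const: "P' (case_nat t e) = P' (case_nat t' e)" for t t' e
    proof -
      have "poly (q e) t = poly (q e) t'" if "q \<in> Q" for q t t'
      proof -
        have "degree (q e) = 0" using poly_fam_degree[OF Q(2)[OF that], of e] True by simp
        then obtain k where "q e = [:k:]" by (meson degree_eq_zeroE)
        then show ?thesis by simp
      qed
      then have "\<And>q t t'. q \<in> Q \<Longrightarrow> sgn (poly (q e) t) = sgn (poly (q e) t')" by metis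
      then show ?thesis using sign_determinedD[OF P'(2)] by blast
    qed
    have "(\<lambda>e. \<not> (c e = 0) \<and> P' (case_nat 0 e)) = (\<lambda>e. c e \<noteq> 0 \<and> (\<exists>t. poly (p e) t = 0 \<and> R e t))"
      using eq lin const by (intro ext) blast
    moreover have "env_sa (\<lambda>e. \<not> (c e = 0) \<and> P' (case_nat 0 e))"
      by (intro env_sa_rules c env_poly_rules env_sa_inst[OF P'(1)])
    ultimately show ?thesis by simp
  next
    case False
    define M where "M = (\<lambda>e. \<Sum>i\<le>n. (c e)\<^sup>2 + (coeff (p e) i)\<^sup>2)"
    have M: "env_poly M" unfolding M_def by (intro env_poly_rules c poly_fam_coeff[OF p])
    define Q1 where "Q1 = insert (\<lambda>e. pderiv (p e)) Q"
    define Q2 where "Q2 = insert (\<lambda>e. [:- M e, (c e)\<^sup>2:]) (insert (\<lambda>e. [:M e, (c e)\<^sup>2:]) Q1)"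
    have fin: "finite Q1" "finite Q2" by (auto simp: Q1_def Q2_def Q)
    have Q1: "poly_fam n q" if "q \<in> Q1" for q
      using that Q(2) poly_fam_pderiv[OF p] by (auto simp: Q1_def)
    have lin: "poly_fam n (\<lambda>e. [:f e, (c e)\<^sup>2:])" if "env_poly f" for f
    proof -
      have "env_poly (\<lambda>e. coeff [:f e, (c e)\<^sup>2:] i)" for i
        unfolding coeff_pCons using that c by (intro env_poly_case_nat env_poly_rules) auto
      moreover have "degree [:f e, (c e)\<^sup>2:] \<le> n" for e
        using False by (intro order_trans[OF degree_pCons_le]) auto
      ultimately show ?thesis by (simp add: poly_fam_def)
    qed
    have Q2: "poly_fam n q" if "q \<in> Q2" for q
      using that Q1 lin[OF M] lin[OF env_poly_uminus[OF M]] by (auto simp: Q2_def)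
    have pd: "(\<lambda>e. pderiv (p e)) \<in> Q2" unfolding Q1_def Q2_def by (intro insertI2 insertI1)
    define C1 where "C1 = (\<lambda>e. \<exists>q\<in>Q1. q e \<noteq> 0 \<and> (\<exists>t. poly (q e) t = 0 \<and> (poly (p e) t = 0 \<and> R e t)))"
    define C2 where "C2 = (\<lambda>e. \<exists>r\<in>Q2. r e \<noteq> 0 \<and> (\<exists>a. poly (r e) a = 0 \<and>
      (\<exists>r'\<in>Q2. r' e \<noteq> 0 \<and> (\<exists>b. poly (r' e) b = 0 \<and> (a < b \<and>
        \<not> (\<exists>q\<in>Q2. q e \<noteq> 0 \<and> (\<exists>z. poly (q e) z = 0 \<and> (a < z \<and> z < b))) \<and>
        poly (p e) a * poly (p e) b < 0 \<and> P' (case_nat ((a + b) / 2) e))))))"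
    note ps = env_poly_poly[OF poly_fam_subst[OF p]]
    have "env_sa C1" unfolding C1_def
      by (intro env_sa_rules fin Suc.IH Q1 R ps env_poly_rules)
    moreover have "env_sa C2"
    proof -
      have P'2: "env_sa (\<lambda>e. P' (case_nat ((e (Suc 0) + e 0) / 2) (\<lambda>i. e (Suc (Suc i)))))"
        by (rule env_sa_subst[OF P'(1), of "\<lambda>i e. case_nat ((e (Suc 0) + e 0) / 2) (\<lambda>i. e (Suc (Suc i))) i"])
           (auto intro!: env_poly_case_nat env_poly_rules)
      \<comment> \<open>\<open>C2\<close> nests quantifiers over roots. Each inner one is eliminated
        by the induction hypothesis for a family whose parameters are shifted past the variables
        already bound.\<close>
      have s: "poly_fam n (\<lambda>e. q (\<lambda>i. e (Suc i)))" "poly_fam n (\<lambda>e. q (\<lambda>i. e (Suc (Suc i))))"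
        if "q \<in> Q2" for q
        by (rule poly_fam_subst[OF Q2[OF that]], rule env_poly.var)+
      show ?thesis unfolding C2_def
        by (intro env_sa_rules fin Suc.IH Q2 s P'2 ps env_poly_rules)
    qed
    ultimately have "env_sa (\<lambda>e. \<not> (c e = 0) \<and> (C1 e \<or> C2 e))"
      by (intro env_sa_rules c env_poly_rules)
    moreover have "(\<lambda>e. \<not> (c e = 0) \<and> (C1 e \<or> C2 e)) = (\<lambda>e. c e \<noteq> 0 \<and> (\<exists>t. poly (p e) t = 0 \<and> R e t))"
    proof (intro ext conj_cong iffI; (erule disjE)?)
      fix e assume "C1 e"
      then show "\<exists>t. poly (p e) t = 0 \<and> R e t" by (auto simp: C1_def)
    next
      fix e assume "\<not> (c e = 0)" "C2 e"
      then obtain a b where ab: "a < b" "poly (p e) a * poly (p e) b < 0" "P' (case_nat ((a + b) / 2) e)"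
        and nor: "\<And>q z. q \<in> Q2 \<Longrightarrow> q e \<noteq> 0 \<Longrightarrow> poly (q e) z = 0 \<Longrightarrow> a < z \<Longrightarrow> z < b \<Longrightarrow> False"
        by (auto simp: C2_def)
      obtain t where t: "a < t" "t < b" "poly (p e) t = 0" using poly_IVT[OF ab(1,2)] by blast
      have "P' (case_nat t e)"
      proof (rule sign_determinedD[OF P'(2) _ ab(3)])
        fix q assume "q \<in> Q"
        then have q: "q \<in> Q2" by (auto simp: Q1_def Q2_def)
        show "sgn (poly (q e) ((a + b) / 2)) = sgn (poly (q e) t)"
        proof (rule poly_sgn_constant)
          fix z assume "q e \<noteq> 0" "min ((a + b) / 2) t \<le> z" "z \<le> max ((a + b) / 2) t"
          moreover from this have "a < z" "z < b"
            using ab(1) t(1,2) by (auto simp: min_def max_def split: if_splits)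
          ultimately show "poly (q e) z \<noteq> 0" using nor[OF q] by blast
        qed
      qed
      then have "R e t" using eq[OF _ t(3)] \<open>\<not> (c e = 0)\<close> by simp
      then show "\<exists>t. poly (p e) t = 0 \<and> R e t" using t by blast
    next
      fix e assume c0: "c e \<noteq> 0" and "\<exists>t. poly (p e) t = 0 \<and> R e t"
      then obtain t where t: "poly (p e) t = 0" "R e t" by blast
      show "C1 e \<or> C2 e"
      proof (rule disjCI)
        assume "\<not> C2 e"
        show "C1 e"
        proof (rule ccontr)
          assume nC1: "\<not> C1 e"
          define Z where "Z = {z. \<exists>q\<in>Q2. q e \<noteq> 0 \<and> poly (q e) z = 0}"
          have finZ: "finite Z" unfolding Z_def by (rule finite_roots_family[OF fin(2)])
          have bound: "\<bar>t\<bar> < M e / (c e)\<^sup>2"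
            using poly_root_bound[OF poly_fam_degree[OF p, of e] _ t(1)] c0 by (simp add: M_def c_def)
          have Zends: "M e / (c e)\<^sup>2 \<in> Z" "- M e / (c e)\<^sup>2 \<in> Z"
            using c0 by (auto simp: Z_def Q2_def)
          \<comment> \<open>A common root with a member of \<open>Q1\<close> would establish
            \<open>C1\<close>, and the two linear polynomials vanish only at the bounds, which are
            strictly beyond every root of \<open>p\<close>.\<close>
          have tZ: "t \<notin> Z"
          proof
            assume "t \<in> Z"
            then obtain q where q: "q \<in> Q2" "q e \<noteq> 0" "poly (q e) t = 0" by (auto simp: Z_def)
            have "q \<in> Q1" 
            proof (rule ccontr)
              assume "q \<notin> Q1"
              with q have "t * (c e)\<^sup>2 = M e \<or> t * (c e)\<^sup>2 = - M e" by (auto simp: Q2_def)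
              then have "t = M e / (c e)\<^sup>2 \<or> t = - (M e / (c e)\<^sup>2)" using c0 by (auto simp: field_simps)
              then show False using bound unfolding abs_less_iff by linarith
            qed
            then show False using nC1 q t by (auto simp: C1_def)
          qed
          define a where "a = Max {z\<in>Z. z < t}"
          define b where "b = Min {z\<in>Z. z > t}"
          have ne: "{z\<in>Z. z < t} \<noteq> {}" "{z\<in>Z. z > t} \<noteq> {}" using Zends bound by auto
          have a: "a \<in> Z" "a < t" using Max_in[OF _ ne(1)] finZ by (auto simp: a_def)
          have b: "b \<in> Z" "t < b" using Min_in[OF _ ne(2)] finZ by (auto simp: b_def)
          have gap: "z \<notin> Z" if "a < z" "z < b" for z
          proof
            assume z: "z \<in> Z"
            then have "z \<noteq> t" using tZ by auto
            then consider "z < t" | "z > t" by linarith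
            then show False
            proof cases
              case 1
              then have "z \<le> a" unfolding a_def using finZ z by (intro Max_ge) auto
              then show ?thesis using that by simp
            next
              case 2
              then have "b \<le> z" unfolding b_def using finZ z by (intro Min_le) auto
              then show ?thesis using that by simp
            qed
          qed
          have nopd: "poly (pderiv (p e)) z \<noteq> 0" if "a < z" "z < b" for z
          proof
            assume z: "poly (pderiv (p e)) z = 0"
            \<comment> \<open>\<open>Z\<close> collects roots of nonzero polynomials only, so the
              derivative must not vanish identically: its coefficient of degree \<open>n\<close> is
              \<open>Suc n\<close> times the leading coefficient of \<open>p\<close>.\<close>
            have "pderiv (p e) \<noteq> 0"
            proof
              assume "pderiv (p e) = 0"
              then have "coeff (pderiv (p e)) n = 0" by simp
              then show False using c0 by (simp add: coeff_pderiv c_def)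
            qed
            then have "z \<in> Z" unfolding Z_def mem_Collect_eq using z
              by (intro bexI[OF _ pd] conjI)
            then show False using gap[OF that] by blast
          qed
          have "poly (p e) a * poly (p e) b < 0"
          proof -
            \<comment> \<open>Since p(t) = 0, the mean value theorem on both sides of
              \<open>t\<close> gives p(a) = -(t - a) p'(x) and p(b) = (b - t) p'(y), where p' has
              the same nonzero sign at \<open>x\<close> and \<open>y\<close>.\<close>
            obtain x where x: "a < x" "x < t" "poly (p e) t - poly (p e) a = (t - a) * poly (pderiv (p e)) x"
              using poly_MVT[OF a(2)] by blast
            obtain y where y: "t < y" "y < b" "poly (p e) b - poly (p e) t = (b - t) * poly (pderiv (p e)) y"
              using poly_MVT[OF b(2)] by blast
            have "sgn (poly (pderiv (p e)) x) = sgn (poly (pderiv (p e)) y)"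
              using nopd x y a b by (intro poly_sgn_constant) auto
            moreover have "poly (pderiv (p e)) x \<noteq> 0" using nopd x b by auto
            ultimately have "poly (pderiv (p e)) x * poly (pderiv (p e)) y > 0"
              by (auto simp: sgn_if zero_less_mult_iff split: if_splits)
            then have "((t - a) * (b - t)) * (poly (pderiv (p e)) x * poly (pderiv (p e)) y) > 0"
              using a(2) b(2) by simp
            moreover have "poly (p e) a * poly (p e) b
              = - (((t - a) * (b - t)) * (poly (pderiv (p e)) x * poly (pderiv (p e)) y))"
            proof -
              have "poly (p e) a = - ((t - a) * poly (pderiv (p e)) x)"
                "poly (p e) b = (b - t) * poly (pderiv (p e)) y"
                using x(3) y(3) t(1) by linarith+
              then show ?thesis by (simp only:) (simp add: algebra_simps)
            qed
            ultimately show ?thesis by linarith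
          qed
          moreover have "P' (case_nat ((a + b) / 2) e)"
          proof (rule sign_determinedD[OF P'(2)])
            show "P' (case_nat t e)" using eq[OF c0 t(1)] t(2) by simp
            fix q assume "q \<in> Q"
            then have "q e = 0 \<or> poly (q e) z \<noteq> 0" if "a < z" "z < b" for z
              using gap[OF that] by (auto simp: Z_def Q1_def Q2_def)
            moreover have "a < z" "z < b"
              if "min t ((a + b) / 2) \<le> z" "z \<le> max t ((a + b) / 2)" for z
              using that a b by (auto simp: min_def max_def split: if_splits)
            ultimately show "sgn (poly (q e) t) = sgn (poly (q e) ((a + b) / 2))"
              by (intro poly_sgn_constant) blast
          qed
          moreover have "\<not> (\<exists>q\<in>Q2. q e \<noteq> 0 \<and> (\<exists>z. poly (q e) z = 0 \<and> (a < z \<and> z < b)))"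
            using gap by (auto simp: Z_def)
          moreover obtain r where "r \<in> Q2" "r e \<noteq> 0" "poly (r e) a = 0" using a by (auto simp: Z_def)
          moreover obtain r' where "r' \<in> Q2" "r' e \<noteq> 0" "poly (r' e) b = 0" using b by (auto simp: Z_def)
          moreover have "a < b" using a b by simp
          ultimately have "C2 e" unfolding C2_def
            by (intro bexI[of _ r] conjI exI[of _ a] bexI[of _ r'] exI[of _ b])
          with \<open>\<not> C2 e\<close> show False by simp
        qed
      qed
    qed auto
    ultimately show ?thesis by simp
  qed
  have "(\<lambda>e. p e \<noteq> 0 \<and> (\<exists>t. poly (p e) t = 0 \<and> R e t)) =
    (\<lambda>e. (c e = 0 \<and> (p e - monom (c e) (Suc n) \<noteq> 0 \<and>
      (\<exists>t. poly (p e - monom (c e) (Suc n)) t = 0 \<and> R e t))) \<or>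
      (c e \<noteq> 0 \<and> (\<exists>t. poly (p e) t = 0 \<and> R e t)))"
  proof
    fix e
    show "(p e \<noteq> 0 \<and> (\<exists>t. poly (p e) t = 0 \<and> R e t)) =
      ((c e = 0 \<and> (p e - monom (c e) (Suc n) \<noteq> 0 \<and>
      (\<exists>t. poly (p e - monom (c e) (Suc n)) t = 0 \<and> R e t))) \<or>
      (c e \<noteq> 0 \<and> (\<exists>t. poly (p e) t = 0 \<and> R e t)))"
      by (cases "c e = 0") (auto simp: c_def)
  qed
  moreover have "env_sa \<dots>"
    by (rule env_sa.disj[OF env_sa_conj[OF env_sa_eq[OF c env_poly.const] trunc] main])
  ultimately show ?case by (simp only:)
qed

text \<open>Sample points for all cells cut out by the roots: the roots themselves, a midpoint for
  each bounded gap, a root shifted by 1 for the two unbounded intervals, and 0 in case there are no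
  roots. Midpoints of non-consecutive roots are harmless, because any sample point satisfying
  \<open>P\<close> is a genuine witness.\<close>

lemma env_sa_ex:
  assumes "env_sa P"
  shows "env_sa (\<lambda>e. \<exists>t. P (case_nat t e))"
proof -
  obtain Q where Q: "finite Q" "\<And>q. q \<in> Q \<Longrightarrow> \<exists>n. poly_fam n q" and sd: "sign_determined Q P"
    using env_sa_signs[OF assms] by blast
  define C where "C = (\<lambda>e. P (case_nat 0 e) \<or> (\<exists>r\<in>Q. r e \<noteq> 0 \<and> (\<exists>a. poly (r e) a = 0 \<and>
     (P (case_nat a e) \<or> P (case_nat (a - 1) e) \<or> P (case_nat (a + 1) e) \<or>
      (\<exists>r'\<in>Q. r' e \<noteq> 0 \<and> (\<exists>b. poly (r' e) b = 0 \<and> P (case_nat ((a + b) / 2) e)))))))"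
  have ex_root: "env_sa (\<lambda>e. q e \<noteq> 0 \<and> (\<exists>t. poly (q e) t = 0 \<and> R e t))"
    if "\<exists>n. poly_fam n q" "env_sa (\<lambda>e. R (\<lambda>i. e (Suc i)) (e 0))" for q R
    using env_sa_ex_root that by blast
  have inst1: "env_sa (\<lambda>e. P (case_nat (f e) (\<lambda>i. e (Suc i))))" if "env_poly f" for f
    by (rule env_sa_subst[OF assms, of "\<lambda>i e. case_nat (f e) (\<lambda>i. e (Suc i)) i"])
       (auto intro!: env_poly_case_nat env_poly_rules that)
  have inst2: "env_sa (\<lambda>e. P (case_nat (f e) (\<lambda>i. e (Suc (Suc i)))))" if "env_poly f" for f
    by (rule env_sa_subst[OF assms, of "\<lambda>i e. case_nat (f e) (\<lambda>i. e (Suc (Suc i))) i"])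
       (auto intro!: env_poly_case_nat env_poly_rules that)
  have s: "\<exists>n. poly_fam n (\<lambda>e. q (\<lambda>i. e (Suc i)))" if "q \<in> Q" for q
    using Q(2)[OF that] poly_fam_subst[where g = "\<lambda>i e. e (Suc i)"] env_poly.var by blast
  have "env_sa C" unfolding C_def
    by (intro env_sa_rules Q ex_root s env_sa_inst assms inst1 inst2 env_poly_rules)
  moreover have "C = (\<lambda>e. \<exists>t. P (case_nat t e))"
  proof (intro ext iffI)
    fix e assume "C e" then show "\<exists>t. P (case_nat t e)" by (auto simp: C_def)
  next
    fix e assume "\<exists>t. P (case_nat t e)"
    then obtain t where t: "P (case_nat t e)" by blast
    define Z where "Z = {z. \<exists>q\<in>Q. q e \<noteq> 0 \<and> poly (q e) z = 0}"
    have finZ: "finite Z" unfolding Z_def by (rule finite_roots_family[OF Q(1)])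
    have move: "P (case_nat t' e)" if "\<And>z. min t t' \<le> z \<Longrightarrow> z \<le> max t t' \<Longrightarrow> z \<notin> Z" for t'
      by (rule sign_determinedD[OF sd _ t], rule poly_sgn_constant) (use that in \<open>auto simp: Z_def\<close>)
    have inC: "C e" if "a \<in> Z" "P (case_nat a e) \<or> P (case_nat (a - 1) e) \<or> P (case_nat (a + 1) e) \<or>
      (\<exists>b\<in>Z. P (case_nat ((a + b) / 2) e))" for a
      using that unfolding C_def Z_def by blast
    show "C e"
    proof (cases "t \<in> Z")
      case True
      then show ?thesis using inC t by blast
    next
      case tZ: False
      define A where "A = {z\<in>Z. z < t}"
      define B where "B = {z\<in>Z. z > t}"
      have fin: "finite A" "finite B" using finZ by (auto simp: A_def B_def)
      have Zle: "z \<le> Max A" if "z \<in> Z" "z < t" for z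
        using that fin by (intro Max_ge) (auto simp: A_def)
      have Zge: "Min B \<le> z" if "z \<in> Z" "t < z" for z
        using that fin by (intro Min_le) (auto simp: B_def)
      have A: "Max A \<in> Z" "Max A < t" if "A \<noteq> {}" using Max_in[OF fin(1) that] by (auto simp: A_def)
      have B: "Min B \<in> Z" "t < Min B" if "B \<noteq> {}" using Min_in[OF fin(2) that] by (auto simp: B_def)
      have Zcase: "z \<noteq> t" if "z \<in> Z" for z using that tZ by auto
      consider "A = {}" "B = {}" | "A \<noteq> {}" "B = {}" | "A = {}" "B \<noteq> {}" | "A \<noteq> {}" "B \<noteq> {}" by blast
      then show ?thesis
      proof cases
        case 1
        have "z \<notin> Z" for z using 1 Zcase[of z] by (force simp: A_def B_def)
        then show ?thesis using move[of 0] by (simp add: C_def)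
      next
        case 2
        have "P (case_nat (Max A + 1) e)"
        proof (rule move)
          fix z assume z: "min t (Max A + 1) \<le> z"
          show "z \<notin> Z"
          proof
            assume "z \<in> Z"
            then have "z < t" using 2 Zcase[of z] by (force simp: B_def)
            then show False using Zle[OF \<open>z \<in> Z\<close>] z A[OF 2(1)] by auto
          qed
        qed
        then show ?thesis using inC A[OF 2(1)] by blast
      next
        case 3
        have "P (case_nat (Min B - 1) e)"
        proof (rule move)
          fix z assume z: "z \<le> max t (Min B - 1)"
          show "z \<notin> Z"
          proof
            assume "z \<in> Z"
            then have "z > t" using 3 Zcase[of z] by (force simp: A_def)
            then show False using Zge[OF \<open>z \<in> Z\<close>] z B[OF 3(2)] by auto
          qed
        qed
        then show ?thesis using inC B[OF 3(2)] by blast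
      next
        case 4
        have "P (case_nat ((Max A + Min B) / 2) e)"
        proof (rule move)
          fix z assume z: "min t ((Max A + Min B) / 2) \<le> z" "z \<le> max t ((Max A + Min B) / 2)"
          show "z \<notin> Z"
          proof
            assume "z \<in> Z"
            then show False using Zge[of z] Zle[of z] z A[OF 4(1)] B[OF 4(2)] Zcase[of z]
              by (auto simp: min_def max_def split: if_splits)
          qed
        qed
        then show ?thesis using inC A[OF 4(1)] B[OF 4(2)] by blast
      qed
    qed
  qed
  ultimately show ?thesis by simp
qed

section \<open>The Tarski-Seidenberg theorem and semialgebraic maps\<close>

lemma semialgebraic_Int: "semialgebraic A \<Longrightarrow> semialgebraic B \<Longrightarrow> semialgebraic (A \<inter> B)"
  using semialgebraic.compl[OF semialgebraic.union[OF semialgebraic.compl semialgebraic.compl], of A B]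
  by simp

lemma semialgebraic_empty: "semialgebraic {}"
  using semialgebraic.pos[of "\<lambda>x. 0"] by (simp add: real_polynomial_function.intros)

lemma semialgebraic_UNIV: "semialgebraic UNIV"
  using semialgebraic.compl[OF semialgebraic_empty] by simp

lemma semialgebraic_Union: "finite I \<Longrightarrow> (\<And>i. i \<in> I \<Longrightarrow> semialgebraic (A i)) \<Longrightarrow> semialgebraic (\<Union>i\<in>I. A i)"
  by (induction rule: finite_induct) (auto intro: semialgebraic_empty semialgebraic.union)

lemma semialgebraic_Inter: "finite I \<Longrightarrow> (\<And>i. i \<in> I \<Longrightarrow> semialgebraic (A i)) \<Longrightarrow> semialgebraic (\<Inter>i\<in>I. A i)"
  by (induction rule: finite_induct) (auto intro: semialgebraic_UNIV semialgebraic_Int)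

lemma semialgebraic_poly_le: "real_polynomial_function p \<Longrightarrow> semialgebraic {x. p x \<le> 0}"
  using semialgebraic.compl[OF semialgebraic.pos] by (simp add: Collect_neg_eq[symmetric] not_less)

lemma semialgebraic_poly_eq: "real_polynomial_function p \<Longrightarrow> semialgebraic {x. p x = 0}"
  using semialgebraic_Int[OF semialgebraic_poly_le semialgebraic_poly_le, of p "\<lambda>x. - p x"]
  by (auto simp: Collect_conj_eq[symmetric] eq_iff)

lemma semialgebraic_vimage:
  assumes "semialgebraic A" "polynomial_function g"
  shows "semialgebraic {x. g x \<in> A}"
  using assms(1)
proof (induction rule: semialgebraic.induct)
  case (pos p)
  then show ?case
    using semialgebraic.pos[OF real_polynomial_function_compose[OF assms(2) pos]] by simp
next
  case (compl A)
  then show ?case using semialgebraic.compl by (fastforce simp: Collect_neg_eq)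
next
  case (union A B)
  then show ?case using semialgebraic.union by (fastforce simp: Collect_disj_eq)
qed

lemma polynomial_function_Pair:
  "polynomial_function f \<Longrightarrow> polynomial_function g \<Longrightarrow>
    polynomial_function (\<lambda>x. (f x :: 'a::euclidean_space, g x :: 'b::euclidean_space))"
  unfolding polynomial_function_iff_Basis_inner[of "\<lambda>x. (f x, g x)"] real_polynomial_function_eq
  by (auto simp: Basis_prod_def intro: polynomial_function_inner)

lemma polynomial_function_fst: "polynomial_function f \<Longrightarrow> polynomial_function (\<lambda>x. fst (f x))"
  using polynomial_function_compose[OF _ polynomial_function_bounded_linear[OF bounded_linear_fst]]
  by (auto simp: o_def)

lemma polynomial_function_snd: "polynomial_function f \<Longrightarrow> polynomial_function (\<lambda>x. snd (f x))"
  using polynomial_function_compose[OF _ polynomial_function_bounded_linear[OF bounded_linear_snd]]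
  by (auto simp: o_def)

lemma polynomial_function_inner_both:
  fixes f g :: "'a::real_normed_vector \<Rightarrow> 'b::euclidean_space"
  assumes "polynomial_function f" "polynomial_function g"
  shows "polynomial_function (\<lambda>x. f x \<bullet> g x)"
proof -
  have "polynomial_function (\<lambda>x. \<Sum>b\<in>Basis. (f x \<bullet> b) *\<^sub>R (g x \<bullet> b))"
    using assms by (intro polynomial_function_sum polynomial_function_mult polynomial_function_inner) auto
  then show ?thesis by (simp flip: euclidean_inner)
qed

lemmas polynomial_function_rules = polynomial_function_inner_both polynomial_function_Pair polynomial_function_fst
  polynomial_function_snd polynomial_function_id polynomial_function_const
  polynomial_function_add polynomial_function_mult polynomial_function_diff
  polynomial_function_minus polynomial_function_inner polynomial_function_sum

section \<open>Passage between environments and points of Euclidean spaces\<close>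

lemma env_poly_polynomial:
  assumes "real_polynomial_function p" and g: "\<And>b. b \<in> Basis \<Longrightarrow> env_poly (\<lambda>e. g e \<bullet> b)"
  shows "env_poly (\<lambda>e. p (g e :: 'a::euclidean_space))"
  using assms(1)
proof (induction rule: real_polynomial_function.induct)
  case (linear f)
  have "f (g e) = (\<Sum>b\<in>Basis. (g e \<bullet> b) * f b)" for e
    by (subst euclidean_representation[symmetric, of "g e"])
       (simp add: linear_sum[OF bounded_linear.linear[OF linear]]
          linear_cmul[OF bounded_linear.linear[OF linear]])
  then show ?case by (auto intro!: env_poly_rules g)
qed (auto intro: env_poly_rules)

lemma env_sa_semialgebraic:
  assumes "semialgebraic A" and g: "\<And>b. b \<in> Basis \<Longrightarrow> env_poly (\<lambda>e. g e \<bullet> b)"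
  shows "env_sa (\<lambda>e. (g e :: 'a::euclidean_space) \<in> A)"
  using assms(1)
proof (induction rule: semialgebraic.induct)
  case (pos p)
  then show ?case using env_sa.pos[OF env_poly_polynomial[OF pos g]] by simp
qed (auto intro: env_sa_rules)

lemma polynomial_env_poly:
  "env_poly f \<Longrightarrow> (\<And>i. real_polynomial_function (\<lambda>x. h x i)) \<Longrightarrow> real_polynomial_function (\<lambda>x. f (h x))"
  by (induction rule: env_poly.induct) (auto intro: real_polynomial_function.intros)

lemma semialgebraic_env_sa:
  fixes h :: "'a::euclidean_space \<Rightarrow> nat \<Rightarrow> real"
  assumes "env_sa P" and h: "\<And>i. real_polynomial_function (\<lambda>x. h x i)"
  shows "semialgebraic {x. P (h x)}"
  using assms(1)
proof (induction rule: env_sa.induct)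
  case (pos f)
  then show ?case using semialgebraic.pos[OF polynomial_env_poly[OF pos h]] by simp
next
  case (neg P)
  then show ?case using semialgebraic.compl by (fastforce simp: Collect_neg_eq)
next
  case (disj P Q)
  then show ?case using semialgebraic.union by (fastforce simp: Collect_disj_eq)
qed

text \<open>Variable 0 holds the eliminated real number and the variables 1, ...,
  \<open>DIM('a)\<close> hold the coordinates of the point with respect to an enumerated basis; then
  \<open>env_sa_ex\<close> applies.\<close>

lemma semialgebraic_ex_real:
  fixes A :: "('a::euclidean_space \<times> real) set"
  assumes "semialgebraic A"
  shows "semialgebraic {x. \<exists>t. (x, t) \<in> A}"
proof -
  obtain f where f: "bij_betw f {..<DIM('a)} (Basis :: 'a set)"
    using ex_bij_betw_nat_finite[OF finite_Basis] by (auto simp: atLeast0LessThan)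
  define g where "g = (\<lambda>e. (\<Sum>i<DIM('a). e (Suc i) *\<^sub>R f i, e 0 :: real))"
  have "env_poly (\<lambda>e. g e \<bullet> b)" for b
    by (cases b) (auto simp: g_def inner_sum_left intro!: env_poly_rules)
  then have "env_sa (\<lambda>e. \<exists>t. g (case_nat t e) \<in> A)"
    by (intro env_sa_ex env_sa_semialgebraic[OF assms])
  then have "semialgebraic {x. \<exists>t. g (case_nat t (\<lambda>i. x \<bullet> f i)) \<in> A}"
    by (rule semialgebraic_env_sa)
       (auto simp: real_polynomial_function_eq intro!: polynomial_function_rules)
  moreover have "g (case_nat t (\<lambda>i. x \<bullet> f i)) = (x, t)" for x t
    using sum.reindex_bij_betw[OF f, of "\<lambda>b. (x \<bullet> b) *\<^sub>R b"] by (simp add: g_def euclidean_representation)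
  ultimately show ?thesis by simp
qed

text \<open>The vector is eliminated one coordinate at a time. The induction on \<open>B\<close>
  lets \<open>y\<close> move freely in the directions of \<open>B\<close> only; for the full basis
  and base point 0 this is quantification over the whole space.\<close>

lemma semialgebraic_ex:
  fixes P :: "'a::euclidean_space \<Rightarrow> 'b::euclidean_space \<Rightarrow> bool"
  assumes "semialgebraic {p. P (fst p) (snd p)}"
  shows "semialgebraic {x. \<exists>y. P x y}"
proof -
  have "semialgebraic {p. \<exists>c. P (fst p) (snd p + (\<Sum>b\<in>B. c b *\<^sub>R b))}"
    if "finite B" for B :: "'b set"
    using that
  proof (induction rule: finite_induct)
    case empty
    then show ?case using assms by simp
  next
    case (insert b B)
    have poly: "polynomial_function (\<lambda>q::('a \<times> 'b) \<times> real. (fst (fst q), snd (fst q) + snd q *\<^sub>R b))"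
      by (intro polynomial_function_rules)
    have "semialgebraic {q::('a \<times> 'b) \<times> real. (fst (fst q), snd (fst q) + snd q *\<^sub>R b) \<in>
      {p. \<exists>c. P (fst p) (snd p + (\<Sum>b\<in>B. c b *\<^sub>R b))}}"
      by (rule semialgebraic_vimage[OF insert.IH poly])
    from semialgebraic_ex_real[OF this]
    have "semialgebraic {p. \<exists>t c. P (fst p) (snd p + t *\<^sub>R b + (\<Sum>b\<in>B. c b *\<^sub>R b))}" by simp
    moreover have "(\<exists>t c. P x (y + t *\<^sub>R b + (\<Sum>b\<in>B. c b *\<^sub>R b))) \<longleftrightarrow>
      (\<exists>c. P x (y + (\<Sum>b\<in>insert b B. c b *\<^sub>R b)))" for x y
    proof
      assume "\<exists>t c. P x (y + t *\<^sub>R b + (\<Sum>b\<in>B. c b *\<^sub>R b))"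
      then obtain t c where tc: "P x (y + t *\<^sub>R b + (\<Sum>b\<in>B. c b *\<^sub>R b))" by blast
      have "(\<Sum>a\<in>insert b B. (c(b := t)) a *\<^sub>R a) = t *\<^sub>R b + (\<Sum>a\<in>B. c a *\<^sub>R a)"
        using insert.hyps by (subst sum.insert) (auto intro!: sum.cong)
      then show "\<exists>c. P x (y + (\<Sum>b\<in>insert b B. c b *\<^sub>R b))"
        using tc by (intro exI[of _ "c(b := t)"]) (simp add: add.assoc)
    next
      assume "\<exists>c. P x (y + (\<Sum>b\<in>insert b B. c b *\<^sub>R b))"
      then obtain c where "P x (y + (\<Sum>b\<in>insert b B. c b *\<^sub>R b))" by blast
      then show "\<exists>t c. P x (y + t *\<^sub>R b + (\<Sum>b\<in>B. c b *\<^sub>R b))"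
        using insert.hyps by (intro exI[of _ "c b"] exI[of _ c]) (simp add: add.assoc)
    qed
    ultimately show ?case by simp
  qed
  from this[OF finite_Basis]
  have "semialgebraic {p::'a \<times> 'b. \<exists>c. P (fst p) (snd p + (\<Sum>b\<in>Basis. c b *\<^sub>R b))}" .
  from semialgebraic_vimage[OF this, of "\<lambda>x. (x, 0)"]
  have "semialgebraic {x. \<exists>c. P x (\<Sum>b\<in>Basis. c b *\<^sub>R b)}"
    by (simp add: polynomial_function_rules)
  moreover have "(\<exists>c. P x (\<Sum>b\<in>Basis. c b *\<^sub>R b)) \<longleftrightarrow> (\<exists>y. P x y)" for x
  proof
    assume "\<exists>y. P x y"
    then obtain y where "P x y" by blast
    then show "\<exists>c. P x (\<Sum>b\<in>Basis. c b *\<^sub>R b)"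
      by (intro exI[of _ "\<lambda>b. y \<bullet> b"]) (simp add: euclidean_representation)
  qed blast
  ultimately show ?thesis by simp
qed

section \<open>Semialgebraic maps\<close>

lemma semialgebraic_map_on_iff:
  "semialgebraic_map_on S f \<longleftrightarrow> semialgebraic {p. fst p \<in> S \<and> snd p = f (fst p)}"
proof -
  have "(\<lambda>x. (x, f x)) ` S = {p. fst p \<in> S \<and> snd p = f (fst p)}" by force
  then show ?thesis by (simp add: semialgebraic_map_on_def)
qed

lemma semialgebraic_graph:
  assumes "semialgebraic_map_on S f" "polynomial_function g" "polynomial_function h"
  shows "semialgebraic {x. g x \<in> S \<and> h x = f (g x)}"
  using semialgebraic_vimage[OF assms(1)[unfolded semialgebraic_map_on_iff] polynomial_function_Pair[OF assms(2,3)]]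
  by simp

lemma semialgebraic_map_on_domain:
  assumes "semialgebraic_map_on S f" shows "semialgebraic S"
  using semialgebraic_ex[of "\<lambda>x y. x \<in> S \<and> y = f x"] assms by (simp add: semialgebraic_map_on_iff)

lemma semialgebraic_map_on_subset:
  assumes "semialgebraic_map_on S f" "semialgebraic S'" "S' \<subseteq> S"
  shows "semialgebraic_map_on S' f"
proof -
  have "{p. fst p \<in> S' \<and> snd p = f (fst p)} =
    {p. fst p \<in> S \<and> snd p = f (fst p)} \<inter> {p. fst p \<in> S'}" using assms(3) by auto
  then show ?thesis
    using assms(1) by (auto simp: semialgebraic_map_on_iff
      intro!: semialgebraic_Int semialgebraic_vimage[OF assms(2)] polynomial_function_rules)
qed

lemma semialgebraic_map_on_cong:
  assumes "\<And>x. x \<in> S \<Longrightarrow> f x = g x"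
  shows "semialgebraic_map_on S f \<longleftrightarrow> semialgebraic_map_on S g"
  using assms by (simp add: semialgebraic_map_on_def cong: image_cong)

lemma semialgebraic_map_on_Un:
  assumes "semialgebraic_map_on S f" "semialgebraic_map_on S' f"
  shows "semialgebraic_map_on (S \<union> S') f"
  using assms by (simp add: semialgebraic_map_on_def image_Un semialgebraic.union)

lemma semialgebraic_map_on_polynomial:
  fixes g :: "'a::euclidean_space \<Rightarrow> 'b::euclidean_space"
  assumes "polynomial_function g"
  shows "semialgebraic_map_on UNIV g"
proof -
  have "{p. fst p \<in> UNIV \<and> snd p = g (fst p)} =
    (\<Inter>b\<in>Basis. {p. (snd p - g (fst p)) \<bullet> b = 0})"
    by (auto simp: inner_diff_left intro: euclidean_eqI)
  moreover have "polynomial_function (\<lambda>p::'a\<times>'b. g (fst p))"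
    using polynomial_function_compose[OF polynomial_function_fst[OF polynomial_function_id] assms]
    by (simp add: o_def)
  ultimately show ?thesis unfolding semialgebraic_map_on_iff
    by (auto intro!: semialgebraic_Inter semialgebraic_poly_eq polynomial_function_rules
      simp: real_polynomial_function_eq)
qed

text \<open>The graph of the composition is a projection of a set in which the intermediate value
  \<open>z\<close> is an additional coordinate, so Tarski-Seidenberg applies.\<close>

lemma semialgebraic_map_on_compose:
  assumes f: "semialgebraic_map_on S f" and g: "semialgebraic_map_on T g" and "f ` S \<subseteq> T"
  shows "semialgebraic_map_on S (\<lambda>x. g (f x))"
proof -
  have "semialgebraic ({q. fst (fst q) \<in> S \<and> snd q = f (fst (fst q))} \<inter>
      {q. snd q \<in> T \<and> snd (fst q) = g (snd q)})"
    by (intro semialgebraic_Int semialgebraic_graph[OF f] semialgebraic_graph[OF g]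
      polynomial_function_rules)
  then have "semialgebraic {q. (\<lambda>p z. (fst p \<in> S \<and> z = f (fst p)) \<and> (z \<in> T \<and> snd p = g z)) (fst q) (snd q)}"
    by (simp add: Collect_conj_eq Int_assoc)
  from semialgebraic_ex[OF this]
  have "semialgebraic {p. \<exists>z. (fst p \<in> S \<and> z = f (fst p)) \<and> (z \<in> T \<and> snd p = g z)}" .
  also have "{p. \<exists>z. (fst p \<in> S \<and> z = f (fst p)) \<and> (z \<in> T \<and> snd p = g z)} =
    {p. fst p \<in> S \<and> snd p = g (f (fst p))}" using assms(3) by auto
  finally show ?thesis by (simp add: semialgebraic_map_on_iff)
qed

lemma semialgebraic_map_on_Pair:
  assumes f: "semialgebraic_map_on S f" and g: "semialgebraic_map_on S g"
  shows "semialgebraic_map_on S (\<lambda>x. (f x, g x))"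
proof -
  have "{p. fst p \<in> S \<and> snd p = (f (fst p), g (fst p))} =
    {p. fst p \<in> S \<and> fst (snd p) = f (fst p)} \<inter> {p. fst p \<in> S \<and> snd (snd p) = g (fst p)}"
    by (auto simp: prod_eq_iff)
  then show ?thesis unfolding semialgebraic_map_on_iff
    by (auto intro!: semialgebraic_Int semialgebraic_graph[OF f] semialgebraic_graph[OF g]
      polynomial_function_rules)
qed

lemma semialgebraic_map_on_vimage:
  assumes f: "semialgebraic_map_on S f" and "semialgebraic T"
  shows "semialgebraic {x\<in>S. f x \<in> T}"
proof -
  have "semialgebraic {p. (\<lambda>x y. (x \<in> S \<and> y = f x) \<and> y \<in> T) (fst p) (snd p)}"
    using semialgebraic_Int[OF f[unfolded semialgebraic_map_on_iff] semialgebraic_vimage[OF assms(2), of snd]]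
    by (simp add: Collect_conj_eq Int_assoc polynomial_function_rules)
  from semialgebraic_ex[OF this] show ?thesis by (simp add: conj_ac cong: conj_cong)
qed

lemma semialgebraic_map_on_image:
  assumes f: "semialgebraic_map_on S f"
  shows "semialgebraic (f ` S)"
proof -
  have "semialgebraic {p. (\<lambda>y x. x \<in> S \<and> y = f x) (fst p) (snd p)}"
    using semialgebraic_graph[OF f, of snd fst] by (simp add: polynomial_function_rules)
  from semialgebraic_ex[OF this] show ?thesis by (simp add: image_def Bex_def)
qed

lemma semialgebraic_map_on_componentwise:
  fixes f :: "'a::euclidean_space \<Rightarrow> 'b::euclidean_space"
  assumes "\<And>b. b \<in> Basis \<Longrightarrow> semialgebraic_map_on S (\<lambda>x. f x \<bullet> b)"
  shows "semialgebraic_map_on S f"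
proof -
  have "{p. fst p \<in> S \<and> snd p = f (fst p)} = (\<Inter>b\<in>Basis. {p. fst p \<in> S \<and> snd p \<bullet> b = f (fst p) \<bullet> b})"
    \<comment> \<open>\<open>Basis\<close> is nonempty; otherwise the intersection would lose the
      condition that the first component lies in \<open>S\<close>.\<close>
    using SOME_Basis by (auto intro: euclidean_eqI)
  then show ?thesis unfolding semialgebraic_map_on_iff
    by (auto intro!: semialgebraic_Inter semialgebraic_graph[OF assms] polynomial_function_rules)
qed

lemma semialgebraic_ball: "semialgebraic (ball (c::'a::euclidean_space) r)"
  and semialgebraic_cball: "semialgebraic (cball c r)"
proof -
  have p: "polynomial_function (\<lambda>x. r\<^sup>2 - (x - c) \<bullet> (x - c))" "polynomial_function (\<lambda>x. (x - c) \<bullet> (x - c) - r\<^sup>2)"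
    by (intro polynomial_function_rules)+
  have 1: "semialgebraic {x. r\<^sup>2 - (x - c) \<bullet> (x - c) > 0}" "semialgebraic {x. (x - c) \<bullet> (x - c) - r\<^sup>2 \<le> 0}"
    by (rule semialgebraic.pos semialgebraic_poly_le, use p in \<open>simp add: real_polynomial_function_eq\<close>)+
  have "ball c r = (if r \<le> 0 then {} else {x. r\<^sup>2 - (x - c) \<bullet> (x - c) > 0})"
    by (auto simp: dist_norm norm_minus_commute[of c] norm_lt_square)
  then show "semialgebraic (ball c r)" using 1 by (simp add: semialgebraic_empty)
  have "cball c r = (if r < 0 then {} else {x. (x - c) \<bullet> (x - c) - r\<^sup>2 \<le> 0})"
    by (auto simp: dist_norm norm_minus_commute[of c] norm_le_square)
  then show "semialgebraic (cball c r)" using 1 by (simp add: semialgebraic_empty)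
qed

text \<open>Neighbourhoods found by topological arguments need not be semialgebraic; around a
  compact set they can be shrunk to a finite union of balls.\<close>

lemma compact_semialgebraic_nbhd:
  fixes K :: "'a::euclidean_space set"
  assumes "compact K" "open G" "K \<subseteq> G"
  obtains W where "open W" "semialgebraic W" "K \<subseteq> W" "W \<subseteq> G"
proof -
  have "\<exists>r>0. ball x r \<subseteq> G" if "x \<in> K" for x using assms that by (meson openE subsetD)
  then obtain r where r: "\<And>x. x \<in> K \<Longrightarrow> r x > 0 \<and> ball x (r x) \<subseteq> G" by metis
  obtain X where X: "X \<subseteq> K" "finite X" "K \<subseteq> (\<Union>x\<in>X. ball x (r x))"
    using compactE_image[OF assms(1), of K "\<lambda>x. ball x (r x)"] r by force
  show thesis
    by (rule that[of "\<Union>x\<in>X. ball x (r x)"])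
       (use X r in \<open>auto intro!: semialgebraic_Union semialgebraic_ball\<close>)
qed

section \<open>Functions of class \<open>C\<^sup>k\<close>\<close>

lemma C_class_on_cong:
  assumes "open U" "C_class_on k U F" "\<And>x. x \<in> U \<Longrightarrow> F x = G x"
  shows "C_class_on k U G"
  using assms
proof (induction k arbitrary: F G)
  case 0
  then show ?case by (simp cong: continuous_on_cong)
next
  case (Suc k)
  have F: "F differentiable (at x)" if "x \<in> U" for x using Suc.prems(2) that by simp
  have "G differentiable (at x)" if "x \<in> U" for x
    using F[OF that] has_derivative_transform_within_open[of F _ x UNIV U G] Suc.prems(1,3) that
    unfolding differentiable_def by blast
  moreover have "frechet_derivative F (at x) = frechet_derivative G (at x)" if "x \<in> U" for x
    using frechet_derivative_transform_within_open[of F x U G] F[OF that] Suc.prems(1,3) that by blast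
  then have "C_class_on k U (\<lambda>x. frechet_derivative G (at x) b)" if "b \<in> Basis" for b
    using Suc.IH[of "\<lambda>x. frechet_derivative F (at x) b" "\<lambda>x. frechet_derivative G (at x) b"]
      Suc.prems(1,2) that by simp
  ultimately show ?case by simp
qed

text \<open>Allows an explicit derivative formula in place of \<open>frechet_derivative\<close>,
  which is defined by choice; uniqueness of the derivative identifies the two.\<close>

lemma C_class_on_SucI:
  assumes "open U" and der: "\<And>x. x \<in> U \<Longrightarrow> (F has_derivative F' x) (at x)"
    and "\<And>b. b \<in> Basis \<Longrightarrow> C_class_on k U (\<lambda>x. F' x b)"
  shows "C_class_on (Suc k) U F"
proof -
  have "frechet_derivative F (at x) = F' x" if "x \<in> U" for x
    using frechet_derivative_at[OF der[OF that]] by simp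
  then have "C_class_on k U (\<lambda>x. frechet_derivative F (at x) b)" if "b \<in> Basis" for b
    using that by (intro C_class_on_cong[OF assms(1) assms(3)[of b]]) auto
  moreover have "F differentiable (at x)" if "x \<in> U" for x
    using der[OF that] unfolding differentiable_def by blast
  ultimately show ?thesis by simp
qed

lemma C_class_on_SucD:
  assumes "C_class_on (Suc k) U F" "x \<in> U"
  shows "(F has_derivative frechet_derivative F (at x)) (at x)"
  using assms by (simp add: frechet_derivative_works)

lemma C_class_on_subset: "C_class_on k U F \<Longrightarrow> V \<subseteq> U \<Longrightarrow> C_class_on k V F"
  by (induction k arbitrary: F) (auto intro: continuous_on_subset)

lemma C_class_on_Un:
  "open U \<Longrightarrow> open V \<Longrightarrow> C_class_on k U F \<Longrightarrow> C_class_on k V F \<Longrightarrow> C_class_on k (U \<union> V) F"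
  by (induction k arbitrary: F) (auto intro: continuous_on_open_Un)

lemma C_class_on_lower: "C_class_on (Suc k) U F \<Longrightarrow> C_class_on k U F"
proof (induction k arbitrary: F)
  case 0
  then show ?case
    by (auto intro!: continuous_at_imp_continuous_on differentiable_imp_continuous_within)
next
  case (Suc k)
  then show ?case by (metis C_class_on.simps(2))
qed

lemma C_class_on_imp_continuous: "C_class_on k U F \<Longrightarrow> continuous_on U F"
  by (induction k) (auto dest: C_class_on_lower simp del: C_class_on.simps(2))

lemma C_class_on_const: "open U \<Longrightarrow> C_class_on k U (\<lambda>x. c)"
proof (induction k arbitrary: c)
  case (Suc k)
  then show ?case by (intro C_class_on_SucI[where F' = "\<lambda>x h. 0"]) auto
qed auto

lemma C_class_on_bounded_linear: "open U \<Longrightarrow> bounded_linear f \<Longrightarrow> C_class_on k U f"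
proof (induction k)
  case 0
  then show ?case by (simp add: linear_continuous_on)
next
  case (Suc k)
  show ?case
    by (rule C_class_on_SucI[where F' = "\<lambda>x. f"])
       (use Suc.prems in \<open>auto intro: C_class_on_const bounded_linear_imp_has_derivative\<close>)
qed

lemma C_class_on_add:
  "open U \<Longrightarrow> C_class_on k U F \<Longrightarrow> C_class_on k U G \<Longrightarrow> C_class_on k U (\<lambda>x. F x + G x)"
proof (induction k arbitrary: F G)
  case 0
  then show ?case by (auto intro: continuous_on_add)
next
  case (Suc k)
  show ?case
    by (rule C_class_on_SucI[OF Suc.prems(1) has_derivative_add[OF C_class_on_SucD C_class_on_SucD]])
       (use Suc in auto)
qed

lemma C_class_on_mult:
  "open U \<Longrightarrow> C_class_on k U F \<Longrightarrow> C_class_on k U G \<Longrightarrow> C_class_on k U (\<lambda>x. F x * G x)"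
proof (induction k arbitrary: F G)
  case 0
  then show ?case by (auto intro: continuous_on_mult)
next
  case (Suc k)
  note lower = C_class_on_lower[OF Suc.prems(2)] C_class_on_lower[OF Suc.prems(3)]
  show ?case
    by (rule C_class_on_SucI[OF Suc.prems(1) has_derivative_mult[OF C_class_on_SucD C_class_on_SucD]])
       (use Suc.IH Suc.prems lower in \<open>auto intro!: C_class_on_add\<close>)
qed

lemma C_class_on_sum:
  "open U \<Longrightarrow> (\<And>i. i \<in> I \<Longrightarrow> C_class_on k U (F i)) \<Longrightarrow> C_class_on k U (\<lambda>x. \<Sum>i\<in>I. F i x)"
  by (induction I rule: infinite_finite_induct) (auto intro: C_class_on_const C_class_on_add)

lemma C_class_on_polynomial: "real_polynomial_function p \<Longrightarrow> open U \<Longrightarrow> C_class_on k U p"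
  by (induction rule: real_polynomial_function.induct)
     (auto intro: C_class_on_const C_class_on_add C_class_on_mult C_class_on_bounded_linear)

text \<open>By the chain rule a partial derivative of the composition is a sum of products of
  partial derivatives of the components of \<open>f\<close> with partial derivatives of
  \<open>g\<close> composed with \<open>f\<close>. The latter fall under the induction hypothesis,
  which therefore varies \<open>g\<close> and keeps \<open>f\<close>.\<close>

lemma C_class_on_compose:
  fixes f :: "'a::euclidean_space \<Rightarrow> 'b::euclidean_space" and g :: "'b \<Rightarrow> real"
  assumes "open U" "open V" "\<And>b. b \<in> Basis \<Longrightarrow> C_class_on k U (\<lambda>x. f x \<bullet> b)"
    "C_class_on k V g" "f ` U \<subseteq> V"
  shows "C_class_on k U (\<lambda>x. g (f x))"
  using assms
proof (induction k arbitrary: g)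
  case 0
  then have "continuous_on U f" using continuous_on_componentwise[of U f] by simp
  with 0 show ?case using continuous_on_compose2[of V g U f] by simp
next
  case (Suc k)
  define f' where "f' = (\<lambda>x h. \<Sum>c\<in>Basis. frechet_derivative (\<lambda>x. f x \<bullet> c) (at x) h *\<^sub>R c)"
  have f': "(f has_derivative f' x) (at x)" if "x \<in> U" for x
  proof -
    have "((\<lambda>x. f x \<bullet> c) has_derivative (\<lambda>h. f' x h \<bullet> c)) (at x)" if c: "c \<in> Basis" for c
      using C_class_on_SucD[OF Suc.prems(3)[OF c] \<open>x \<in> U\<close>] c
      by (simp add: f'_def inner_sum_left_Basis)
    then show ?thesis using has_derivative_componentwise_within[of f "f' x" x UNIV] by blast
  qed
  show ?case
  proof (rule C_class_on_SucI[OF Suc.prems(1)])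
    fix x assume x: "x \<in> U"
    then have fx: "f x \<in> V" using Suc.prems(5) by auto
    show "((\<lambda>x. g (f x)) has_derivative
      (\<lambda>h. \<Sum>c\<in>Basis. frechet_derivative (\<lambda>x. f x \<bullet> c) (at x) h * frechet_derivative g (at (f x)) c)) (at x)"
    proof -
      note g' = C_class_on_SucD[OF Suc.prems(4) fx]
      have "frechet_derivative g (at (f x)) (f' x h) =
        (\<Sum>c\<in>Basis. frechet_derivative (\<lambda>x. f x \<bullet> c) (at x) h * frechet_derivative g (at (f x)) c)" for h
        using has_derivative_linear[OF g'] by (simp add: f'_def linear_sum linear_cmul)
      then show ?thesis using has_derivative_compose[OF f'[OF x] g'] by simp
    qed
  next
    fix b :: 'a assume b: "b \<in> Basis"
    have lower: "C_class_on k U (\<lambda>x. f x \<bullet> c)" if "c \<in> Basis" for c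
      by (rule C_class_on_lower[OF Suc.prems(3)[OF that]])
    have "C_class_on k U (\<lambda>x. frechet_derivative g (at (f x)) c)" if c: "c \<in> Basis" for c
      by (rule Suc.IH[OF Suc.prems(1,2) lower _ Suc.prems(5)]) (use Suc.prems(4) c in auto)
    then show "C_class_on k U (\<lambda>x. \<Sum>c\<in>Basis. frechet_derivative (\<lambda>x. f x \<bullet> c) (at x) b *
      frechet_derivative g (at (f x)) c)"
      using Suc.prems(1,3) b by (auto intro!: C_class_on_sum C_class_on_mult)
  qed
qed

text \<open>The derivative is again a polynomial expression in \<open>inverse\<close>, so the
  product rule closes the induction.\<close>

lemma C_class_on_inverse: "C_class_on k {x. x \<noteq> 0} (inverse :: real \<Rightarrow> real)"
proof (induction k)
  case 0
  then show ?case by (auto intro: continuous_intros)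
next
  case (Suc k)
  have op: "open {x::real. x \<noteq> 0}" by (simp add: open_Collect_neq)
  show ?case
    by (rule C_class_on_SucI[where F' = "\<lambda>x h. (- h) * (inverse x * inverse x)", OF op])
       (use C_class_on_mult[OF op C_class_on_const[OF op, of k "-1"] C_class_on_mult[OF op Suc Suc]]
        in \<open>auto intro!: derivative_eq_intros\<close>)
qed

text \<open>Besides the inverse, the only non-polynomial building block of the construction.\<close>

definition pos_power :: "nat \<Rightarrow> real \<Rightarrow> real" where
  "pos_power k x = max 0 x ^ Suc k"

lemma pos_power_simps: "pos_power k x \<ge> 0" "x \<le> 0 \<Longrightarrow> pos_power k x = 0" "0 < x \<Longrightarrow> pos_power k x > 0"
  "x \<le> 1 \<Longrightarrow> pos_power k x \<le> 1"
proof -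
  show "pos_power k x \<le> 1" if "x \<le> 1"
    unfolding pos_power_def using that by (intro power_le_one) auto
qed (auto simp: pos_power_def max_def)

text \<open>Differentiation lowers the index by one and ends at the continuous function max 0 x;
  this makes \<open>pos_power k\<close> exactly suited to class C^k.\<close>

lemma DERIV_pos_power: "(pos_power (Suc k) has_real_derivative real (k + 2) * pos_power k x) (at x)"
proof -
  consider "x > 0" | "x < 0" | "x = 0" by linarith
  then show ?thesis
  proof cases
    case 1
    have "((\<lambda>x. x ^ (k + 2)) has_real_derivative real (k + 2) * pos_power k x) (at x)"
      using DERIV_pow[of "k + 2" x] 1 by (simp add: pos_power_def)
    then show ?thesis
      by (rule has_field_derivative_transform_within_open[of _ _ _ "{0<..}"])
         (use 1 in \<open>auto simp: pos_power_def\<close>)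
  next
    case 2
    have "((\<lambda>x. 0) has_real_derivative real (k + 2) * pos_power k x) (at x)"
      using 2 by (simp add: pos_power_simps)
    then show ?thesis
      by (rule has_field_derivative_transform_within_open[of _ _ _ "{..<0}"])
         (use 2 in \<open>auto simp: pos_power_simps\<close>)
  next
    case 3
    \<comment> \<open>Caratheodory's criterion at the gluing point: the difference quotient at 0 is
      \<open>pos_power k\<close>, continuous with value 0 there.\<close>
    have "isCont (pos_power k) 0" unfolding pos_power_def by (intro continuous_intros)
    moreover have "pos_power (Suc k) z - pos_power (Suc k) 0 = pos_power k z * (z - 0)" for z
      by (auto simp: pos_power_def max_def)
    ultimately show ?thesis using 3
      unfolding CARAT_DERIV by (intro exI[of _ "pos_power k"]) (simp add: pos_power_simps)
  qed
qed

lemma C_class_on_pos_power: "C_class_on k UNIV (pos_power k)"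
proof (induction k)
  case 0
  then show ?case by (auto simp: pos_power_def intro!: continuous_intros)
next
  case (Suc k)
  show ?case
    by (rule C_class_on_SucI[OF open_UNIV DERIV_pos_power[unfolded has_field_derivative_def]])
       (auto intro!: C_class_on_mult C_class_on_const Suc)
qed

lemma semialgebraic_map_on_inverse: "semialgebraic_map_on {x. x \<noteq> 0} (inverse :: real \<Rightarrow> real)"
proof -
  have "{p. fst p \<in> {x. x \<noteq> 0} \<and> snd p = inverse (fst p)} = {p::real \<times> real. fst p * snd p - 1 = 0}"
    by (auto intro: inverse_unique[symmetric])
  moreover have "semialgebraic {p::real \<times> real. fst p * snd p - 1 = 0}"
  proof -
    have "polynomial_function (\<lambda>p::real \<times> real. fst p *\<^sub>R snd p - 1)"
      by (intro polynomial_function_rules)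
    then show ?thesis by (intro semialgebraic_poly_eq) (simp add: real_polynomial_function_eq)
  qed
  ultimately show ?thesis by (simp add: semialgebraic_map_on_iff)
qed

lemma semialgebraic_map_on_pos_power: "semialgebraic_map_on UNIV (pos_power k)"
proof -
  have p: "polynomial_function (\<lambda>x::real. 0::real)" "polynomial_function (\<lambda>x::real. x ^ Suc k)"
    using real_polynomial_function_power[of "\<lambda>x::real. x" "Suc k"]
    by (auto simp: real_polynomial_function_eq)
  have s: "semialgebraic {x::real. x > 0}" "semialgebraic {x::real. x \<le> 0}"
    using semialgebraic.pos semialgebraic_poly_le by (auto simp: real_polynomial_function_eq)
  have "semialgebraic_map_on {x. x > 0} (pos_power k)"
    using semialgebraic_map_on_subset[OF semialgebraic_map_on_polynomial[OF p(2)] s(1)]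
    by (subst semialgebraic_map_on_cong) (auto simp: pos_power_def)
  moreover have "semialgebraic_map_on {x. x \<le> 0} (pos_power k)"
    using semialgebraic_map_on_subset[OF semialgebraic_map_on_polynomial[OF p(1)] s(2)]
    by (subst semialgebraic_map_on_cong) (auto simp: pos_power_def)
  moreover have "{x::real. x > 0} \<union> {x. x \<le> 0} = UNIV" by auto
  ultimately show ?thesis using semialgebraic_map_on_Un by fastforce
qed

section \<open>Calculus of S^\<nu> maps on open sets\<close>

definition Snu_on :: "nat \<Rightarrow> 'a::euclidean_space set \<Rightarrow> ('a \<Rightarrow> 'b::euclidean_space) \<Rightarrow> bool" where
  "Snu_on k U f \<longleftrightarrow> open U \<and> semialgebraic_map_on U f \<and> (\<forall>b\<in>Basis. C_class_on k U (\<lambda>x. f x \<bullet> b))"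

text \<open>Semialgebraicity of the domain is not a conjunct of \<open>Snu_on\<close>; it follows by
  projecting the graph.\<close>

lemma Snu_on_domain: assumes "Snu_on k U f" shows "open U" "semialgebraic U"
  using assms semialgebraic_map_on_domain by (auto simp: Snu_on_def)

lemma Snu_on_continuous: "Snu_on k U f \<Longrightarrow> continuous_on U f"
  by (auto simp: Snu_on_def continuous_on_componentwise[of U f] intro: C_class_on_imp_continuous)

lemma Snu_on_subset: "Snu_on k U f \<Longrightarrow> open V \<Longrightarrow> semialgebraic V \<Longrightarrow> V \<subseteq> U \<Longrightarrow> Snu_on k V f"
  using semialgebraic_map_on_subset C_class_on_subset by (fastforce simp: Snu_on_def)

lemma Snu_on_cong: "Snu_on k U f \<Longrightarrow> (\<And>x. x \<in> U \<Longrightarrow> f x = g x) \<Longrightarrow> Snu_on k U g"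
  using semialgebraic_map_on_cong[of U f g] C_class_on_cong[of U k "\<lambda>x. f x \<bullet> b" "\<lambda>x. g x \<bullet> b" for b]
  by (auto simp: Snu_on_def)

lemma Snu_on_Un: "Snu_on k U f \<Longrightarrow> Snu_on k V f \<Longrightarrow> Snu_on k (U \<union> V) f"
  by (auto simp: Snu_on_def intro: semialgebraic_map_on_Un C_class_on_Un)

lemma Snu_on_vimage:
  assumes "Snu_on k U f" "open V" "semialgebraic V"
  shows "open {x\<in>U. f x \<in> V}" "semialgebraic {x\<in>U. f x \<in> V}"
proof -
  have "{x\<in>U. f x \<in> V} = U \<inter> f -` V" by auto
  then show "open {x\<in>U. f x \<in> V}"
    using Snu_on_continuous[OF assms(1)] Snu_on_domain[OF assms(1)] assms(2)
    by (simp add: continuous_on_open_vimage Int_commute)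
  show "semialgebraic {x\<in>U. f x \<in> V}"
    using assms(1,3) unfolding Snu_on_def by (blast intro: semialgebraic_map_on_vimage)
qed

lemma Snu_on_compose:
  assumes "Snu_on k U f" "Snu_on k V g" "f ` U \<subseteq> V"
  shows "Snu_on k U (\<lambda>x. g (f x))"
  using assms semialgebraic_map_on_compose[of U f V g] C_class_on_compose[of U V k f "\<lambda>y. g y \<bullet> b" for b]
  by (auto simp: Snu_on_def)

lemma Snu_on_Pair:
  assumes "Snu_on k U f" "Snu_on k U g"
  shows "Snu_on k U (\<lambda>x. (f x, g x))"
  using assms semialgebraic_map_on_Pair[of U f g] by (auto simp: Snu_on_def Basis_prod_def)

lemma Snu_on_polynomial:
  fixes g :: "'a::euclidean_space \<Rightarrow> 'b::euclidean_space"
  assumes "polynomial_function g" shows "Snu_on k UNIV g"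
  using assms semialgebraic_map_on_polynomial[OF assms] polynomial_function_iff_Basis_inner[of g]
  by (auto simp: Snu_on_def intro: C_class_on_polynomial)

text \<open>Sums, differences and scalar multiples are polynomial maps applied to a pair, so closure
  under the algebraic operations reduces to pairing and composition.\<close>

lemma Snu_on_polynomial_compose:
  "Snu_on k U f \<Longrightarrow> polynomial_function g \<Longrightarrow> Snu_on k U (\<lambda>x. g (f x))"
  using Snu_on_compose[OF _ Snu_on_polynomial] by blast

lemma Snu_on_const: "open U \<Longrightarrow> semialgebraic U \<Longrightarrow> Snu_on k U (\<lambda>x. c)"
  by (rule Snu_on_subset[OF Snu_on_polynomial]) auto

lemma Snu_on_id: "open U \<Longrightarrow> semialgebraic U \<Longrightarrow> Snu_on k U (\<lambda>x. x)"
  by (rule Snu_on_subset[OF Snu_on_polynomial]) auto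

lemma Snu_on_add: "Snu_on k U f \<Longrightarrow> Snu_on k U g \<Longrightarrow> Snu_on k U (\<lambda>x. f x + g x)"
  using Snu_on_polynomial_compose[OF Snu_on_Pair, of k U f g "\<lambda>p. fst p + snd p"]
  by (simp add: polynomial_function_rules)

lemma Snu_on_diff: "Snu_on k U f \<Longrightarrow> Snu_on k U g \<Longrightarrow> Snu_on k U (\<lambda>x. f x - g x)"
  using Snu_on_polynomial_compose[OF Snu_on_Pair, of k U f g "\<lambda>p. fst p - snd p"]
  by (simp add: polynomial_function_rules)

lemma Snu_on_scaleR: "Snu_on k U f \<Longrightarrow> Snu_on k U g \<Longrightarrow> Snu_on k U (\<lambda>x. f x *\<^sub>R g x)"
  using Snu_on_polynomial_compose[OF Snu_on_Pair, of k U f g "\<lambda>p. fst p *\<^sub>R snd p"]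
  by (simp add: polynomial_function_rules)

lemma Snu_on_sum:
  "open U \<Longrightarrow> semialgebraic U \<Longrightarrow> (\<And>i. i \<in> I \<Longrightarrow> Snu_on k U (f i)) \<Longrightarrow> Snu_on k U (\<lambda>x. \<Sum>i\<in>I. f i x)"
  by (induction I rule: infinite_finite_induct) (auto intro: Snu_on_const Snu_on_add)

lemma Snu_on_inverse:
  "Snu_on k U f \<Longrightarrow> (\<And>x. x \<in> U \<Longrightarrow> f x \<noteq> 0) \<Longrightarrow> Snu_on k U (\<lambda>x. inverse (f x) :: real)"
  by (rule Snu_on_compose[of k U f "{x. x \<noteq> 0}"])
     (auto simp: Snu_on_def open_Collect_neq semialgebraic_map_on_inverse C_class_on_inverse)

lemma Snu_on_pos_power: "Snu_on k U f \<Longrightarrow> Snu_on k U (\<lambda>x. pos_power k (f x))"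
  by (rule Snu_on_compose[of k U f UNIV])
     (auto simp: Snu_on_def semialgebraic_map_on_pos_power C_class_on_pos_power)

text \<open>The squared distance is a polynomial, so there is no singularity at the centre; for
  \<open>r > 0\<close> the function is positive exactly on the open ball.\<close>

definition bump :: "nat \<Rightarrow> 'a::euclidean_space \<Rightarrow> real \<Rightarrow> 'a \<Rightarrow> real" where
  "bump k c r x = pos_power k (r\<^sup>2 - (x - c) \<bullet> (x - c))"

lemma Snu_on_bump: "Snu_on k UNIV (bump k c r)"
  unfolding bump_def[abs_def]
  by (intro Snu_on_pos_power Snu_on_polynomial polynomial_function_rules)

lemma bump_nonneg: "bump k c r x \<ge> 0"
  by (simp add: bump_def pos_power_simps)

lemma bump_pos_iff: "r > 0 \<Longrightarrow> bump k c r x > 0 \<longleftrightarrow> x \<in> ball c r"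
proof -
  assume "r > 0"
  have "bump k c r x > 0 \<longleftrightarrow> (x - c) \<bullet> (x - c) < r\<^sup>2"
    using pos_power_simps[where x = "r\<^sup>2 - (x - c) \<bullet> (x - c)" and k = k]
    by (cases "(x - c) \<bullet> (x - c) < r\<^sup>2") (auto simp: bump_def)
  also have "\<dots> \<longleftrightarrow> norm (x - c) < r" using \<open>r > 0\<close> by (simp add: norm_lt_square)
  finally show ?thesis by (simp add: dist_norm norm_minus_commute)
qed

lemma Snu_open_iff: "Snu_open k U F \<longleftrightarrow> Snu_on k U F" if "open U" for F :: "'a::euclidean_space \<Rightarrow> real"
  using that by (simp add: Snu_open_def Snu_on_def)

section \<open>Near-retractions\<close>

lemma Snu_on_componentwise:
  assumes "open U" "\<And>b. b \<in> Basis \<Longrightarrow> Snu_on k U (\<lambda>x. f x \<bullet> b)"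
  shows "Snu_on k U f"
  using assms semialgebraic_map_on_componentwise[of U f] by (auto simp: Snu_on_def)

text \<open>The balls are chosen by \<open>star\<close>: the ball around \<open>y\<close> meets only cells that contain \<open>y\<close>. Hence the points \<open>y\<close>
  that are active at \<open>z\<close> lie in every cell that contains \<open>z\<close>.\<close>

lemma near_retraction_convex_union:
  fixes \<T> :: "'a::euclidean_space set set"
  assumes "finite \<T>" and cc: "\<And>S. S \<in> \<T> \<Longrightarrow> compact S \<and> convex S" and "\<delta> > 0"
  obtains G \<rho> where "Snu_on k G \<rho>" "\<Union>\<T> \<subseteq> G"
    "\<And>z. z \<in> G \<Longrightarrow> \<rho> z \<in> \<Union>\<T> \<and> norm (\<rho> z - z) < \<delta>"
    "\<And>z. z \<in> \<Union>\<T> \<Longrightarrow> closed_segment z (\<rho> z) \<subseteq> \<Union>\<T>"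
proof -
  let ?Q = "\<Union>\<T>"
  \<comment> \<open>Finitely many closed cells miss \<open>y\<close>, so a whole closed ball misses
    them. Closed balls are taken because \<open>N\<close> below removes them from an open
    set.\<close>
  have "\<exists>r>0. r \<le> \<delta> \<and> (\<forall>S\<in>\<T>. y \<notin> S \<longrightarrow> cball y r \<inter> S = {})" if "y \<in> ?Q" for y
  proof -
    have "open (- \<Union>{S\<in>\<T>. y \<notin> S})"
      using assms(1) cc by (intro open_Compl closed_Union) (auto intro: compact_imp_closed)
    then obtain r where "r > 0" "cball y r \<subseteq> - \<Union>{S\<in>\<T>. y \<notin> S}"
      by (metis (no_types, lifting) ComplI UnionE mem_Collect_eq open_contains_cball)
    then show ?thesis using \<open>\<delta> > 0\<close> by (intro exI[of _ "min r \<delta>"]) auto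
  qed
  then obtain r where r: "\<And>y. y \<in> ?Q \<Longrightarrow> r y > 0 \<and> r y \<le> \<delta>"
    and star: "\<And>y S. y \<in> ?Q \<Longrightarrow> S \<in> \<T> \<Longrightarrow> cball y (r y) \<inter> S \<noteq> {} \<Longrightarrow> y \<in> S"
    by metis
  have compQ: "compact ?Q" using assms(1) cc by (intro compact_Union) auto
  obtain Y where Y: "Y \<subseteq> ?Q" "finite Y" "?Q \<subseteq> (\<Union>y\<in>Y. ball y (r y))"
    using compactE_image[OF compQ, of ?Q "\<lambda>y. ball y (r y)"] r by force
  define G0 where "G0 = (\<Union>y\<in>Y. ball y (r y))"
  define s where "s = (\<lambda>z. \<Sum>y\<in>Y. bump k y (r y) z)"
  define \<rho> where "\<rho> = (\<lambda>z. inverse (s z) *\<^sub>R (\<Sum>y\<in>Y. bump k y (r y) z *\<^sub>R y))"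
  have G0: "open G0" "semialgebraic G0"
    using Y(2) by (auto simp: G0_def intro!: semialgebraic_Union semialgebraic_ball)
  have active: "bump k y (r y) z > 0 \<longleftrightarrow> z \<in> ball y (r y)" if "y \<in> Y" for y z
    using bump_pos_iff r Y(1) that by blast
  have s_pos: "s z > 0" if "z \<in> G0" for z
  proof -
    obtain y where "y \<in> Y" "z \<in> ball y (r y)" using \<open>z \<in> G0\<close> by (auto simp: G0_def)
    then show ?thesis unfolding s_def using active Y(2) by (intro sum_pos2[of Y y] bump_nonneg) auto
  qed
  have bump: "Snu_on k G0 (bump k y (r y))" for y
    using Snu_on_subset[OF Snu_on_bump G0] by simp
  have \<rho>: "Snu_on k G0 \<rho>"
    unfolding \<rho>_def s_def
    by (intro Snu_on_scaleR Snu_on_inverse Snu_on_sum G0 Snu_on_const bump)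
       (use s_pos in \<open>force simp: s_def\<close>)
  have conv: "\<rho> z \<in> C" if "z \<in> G0" "convex C" and C: "\<And>y. y \<in> Y \<Longrightarrow> z \<in> ball y (r y) \<Longrightarrow> y \<in> C" for z C
  proof -
    let ?A = "{y\<in>Y. z \<in> ball y (r y)}"
    have zero: "bump k y (r y) z = 0" if "y \<in> Y - ?A" for y
      using active[of y z] that bump_nonneg[of k y "r y" z] by force
    have "s z = (\<Sum>y\<in>?A. bump k y (r y) z)"
      unfolding s_def using Y(2) zero by (intro sum.mono_neutral_right) auto
    then have one: "(\<Sum>y\<in>?A. inverse (s z) * bump k y (r y) z) = 1"
      using s_pos[OF that(1)] by (simp flip: sum_distrib_left)
    have "\<rho> z = (\<Sum>y\<in>Y. (inverse (s z) * bump k y (r y) z) *\<^sub>R y)"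
      by (simp add: \<rho>_def scaleR_sum_right)
    also have "\<dots> = (\<Sum>y\<in>?A. (inverse (s z) * bump k y (r y) z) *\<^sub>R y)"
      using Y(2) zero by (intro sum.mono_neutral_right) auto
    also have "\<dots> \<in> C"
      using Y(2) C s_pos[OF that(1)] bump_nonneg
      by (intro convex_sum[OF _ that(2) one]) (auto intro!: mult_nonneg_nonneg)
    finally show ?thesis .
  qed
  have near: "norm (\<rho> z - z) < \<delta>" if "z \<in> G0" for z
  proof -
    \<comment> \<open>The ball around \<open>z\<close> is itself convex and contains every active
      centre, since the radii are at most \<delta>.\<close>
    have "\<rho> z \<in> ball z \<delta>"
      by (rule conv[OF that]) (use Y(1) r in \<open>force simp: dist_commute\<close>)+
    then show ?thesis by (simp add: dist_norm norm_minus_commute)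
  qed
  have cell: "\<rho> z \<in> S" if "z \<in> G0" "S \<in> \<T>" "z0 \<in> S"
    "\<And>y. y \<in> Y \<Longrightarrow> z \<in> ball y (r y) \<Longrightarrow> z0 \<in> cball y (r y)" for z z0 S
    by (rule conv[OF that(1)]) (use cc that star Y(1) in blast)+
  \<comment> \<open>For \<open>z\<close> in \<open>N z0\<close>, each ball active at
    \<open>z\<close> also has \<open>z0\<close> in its closure, so all active centres lie in every
    cell through \<open>z0\<close>. This carries the cell argument to points \<open>z\<close> just
    outside the polyhedron; only finitely many closed balls are removed, so \<open>N z0\<close> is
    open.\<close>
  define N where "N = (\<lambda>z0. G0 - (\<Union>y\<in>{y\<in>Y. z0 \<notin> cball y (r y)}. cball y (r y)))"
  have "open (\<Union>z0\<in>?Q. N z0)"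
    unfolding N_def using G0 Y(2) by (intro open_UN ballI open_Diff closed_UN) auto
  moreover have "z \<in> N z" if "z \<in> ?Q" for z using that Y(3) unfolding N_def G0_def by blast
  then have "?Q \<subseteq> (\<Union>z0\<in>?Q. N z0)" by blast
  ultimately obtain G where G: "open G" "semialgebraic G" "?Q \<subseteq> G" "G \<subseteq> (\<Union>z0\<in>?Q. N z0)"
    using compact_semialgebraic_nbhd[OF compQ] by metis
  have GG0: "G \<subseteq> G0" using G(4) by (auto simp: N_def)
  show thesis
  proof
    show "Snu_on k G \<rho>" by (rule Snu_on_subset[OF \<rho> G(1,2) GG0])
    show "?Q \<subseteq> G" by (rule G(3))
  next
    fix z assume z: "z \<in> G"
    then obtain z0 S where z0: "z \<in> N z0" "S \<in> \<T>" "z0 \<in> S" using G(4) by blast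
    have "z0 \<in> cball y (r y)" if "y \<in> Y" "z \<in> ball y (r y)" for y
    proof (rule ccontr)
      assume "z0 \<notin> cball y (r y)"
      moreover have "z \<in> cball y (r y)" using that(2) by simp
      ultimately show False using z0(1) that(1) unfolding N_def by blast
    qed
    then have "\<rho> z \<in> S" using cell z0 GG0 z by blast
    then show "\<rho> z \<in> ?Q \<and> norm (\<rho> z - z) < \<delta>" using near z GG0 z0(2) by blast
  next
    fix z assume "z \<in> ?Q"
    then obtain S where S: "S \<in> \<T>" "z \<in> S" by blast
    have "z \<in> G0" using \<open>z \<in> ?Q\<close> G(3) GG0 by blast
    then have "\<rho> z \<in> S" by (rule cell[OF _ S]) auto
    then show "closed_segment z (\<rho> z) \<subseteq> ?Q"
      using closed_segment_subset[OF S(2), of "\<rho> z"] cc[OF S(1)] S(1) by blast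
  qed
qed

text \<open>A sum of bumps is positive on \<open>L\<close> but not constant there; it is flattened
  by \<open>pos_power\<close>. The support bound \<open>C\<close> is compact and semialgebraic so
  that the complement of its image under a chart inverse is an open semialgebraic set.\<close>

lemma Snu_cutoff:
  fixes L V :: "'a::euclidean_space set"
  assumes "compact L" "open V" "L \<subseteq> V"
  obtains \<theta> :: "'a \<Rightarrow> real" and C W where "Snu_on k UNIV \<theta>" "compact C" "semialgebraic C" "C \<subseteq> V"
    "\<And>y. 0 \<le> \<theta> y \<and> \<theta> y \<le> 1" "\<And>y. y \<notin> C \<Longrightarrow> \<theta> y = 0"
    "open W" "L \<subseteq> W" "\<And>y. y \<in> W \<Longrightarrow> \<theta> y = 1"
proof -
  have "\<exists>r>0. cball y r \<subseteq> V" if "y \<in> L" for y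
    using assms that by (meson open_contains_cball subsetD)
  then obtain r where r: "\<And>y. y \<in> L \<Longrightarrow> r y > 0 \<and> cball y (r y) \<subseteq> V" by metis
  obtain Y where Y: "Y \<subseteq> L" "finite Y" "L \<subseteq> (\<Union>y\<in>Y. ball y (r y))"
    using compactE_image[OF assms(1), of L "\<lambda>y. ball y (r y)"] r by force
  define s where "s = (\<lambda>z. \<Sum>y\<in>Y. bump k y (r y) z)"
  define C where "C = (\<Union>y\<in>Y. cball y (r y))"
  have active: "bump k y (r y) z > 0 \<longleftrightarrow> z \<in> ball y (r y)" if "y \<in> Y" for y z
    using bump_pos_iff r Y(1) that by blast
  have s: "Snu_on k UNIV s"
    unfolding s_def by (intro Snu_on_sum Snu_on_bump semialgebraic_UNIV) auto
  have s_nonneg: "s z \<ge> 0" for z unfolding s_def by (intro sum_nonneg bump_nonneg)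
  have s_pos: "s z > 0" if "z \<in> L" for z
  proof -
    obtain y where "y \<in> Y" "z \<in> ball y (r y)" using \<open>z \<in> L\<close> Y(3) by blast
    then show ?thesis unfolding s_def using active Y(2) by (intro sum_pos2[of Y y] bump_nonneg) auto
  qed
  have s_zero: "s z = 0" if "z \<notin> C" for z
  proof -
    have "bump k y (r y) z = 0" if "y \<in> Y" for y
      using active[OF that, of z] \<open>z \<notin> C\<close> that bump_nonneg[of k y "r y" z] by (force simp: C_def)
    then show ?thesis by (simp add: s_def)
  qed
  have cont: "continuous_on UNIV s" by (rule Snu_on_continuous[OF s])
  obtain c where c: "c > 0" "\<And>z. z \<in> L \<Longrightarrow> c \<le> s z"
  proof (cases "L = {}")
    case False
    then obtain x where "x \<in> L" "\<And>z. z \<in> L \<Longrightarrow> s x \<le> s z"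
      using continuous_attains_inf[OF assms(1) False continuous_on_subset[OF cont]] by auto
    then show ?thesis using that[of "s x"] s_pos by blast
  qed (use that[of 1] in auto)
  \<comment> \<open>With \<open>c\<close> a lower bound of \<open>s\<close> on \<open>L\<close>, the
    argument of \<open>pos_power\<close> is 1 where \<open>s\<close> vanishes, giving \<theta> = 0,
    and nonpositive once \<open>s\<close> reaches c/2, giving \<theta> = 1. Using c/2 rather than
    \<open>c\<close> makes this hold on a neighbourhood of \<open>L\<close>.\<close>
  define \<theta> where "\<theta> = (\<lambda>z. 1 - pos_power k (1 - (2 / c) *\<^sub>R s z))"
  show thesis
  proof
    show "Snu_on k UNIV \<theta>"
      unfolding \<theta>_def by (intro Snu_on_diff Snu_on_pos_power Snu_on_scaleR s Snu_on_const semialgebraic_UNIV) auto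
    show "compact C" unfolding C_def using Y(2) by (intro compact_UN) auto
    show "semialgebraic C" unfolding C_def using Y(2) by (intro semialgebraic_Union semialgebraic_cball)
    show "C \<subseteq> V" unfolding C_def using r Y(1) by blast
    show "0 \<le> \<theta> y \<and> \<theta> y \<le> 1" for y
      using s_nonneg[of y] c(1) by (auto simp: \<theta>_def pos_power_simps)
    show "\<theta> y = 0" if "y \<notin> C" for y using s_zero[OF that] by (simp add: \<theta>_def pos_power_def)
    have "{z. s z > c / 2} = s -` {c/2<..}" by auto
    then show "open {z. s z > c / 2}" using cont by (simp add: open_vimage)
    show "L \<subseteq> {z. s z > c / 2}" using c by force
    show "\<theta> y = 1" if "y \<in> {z. s z > c / 2}" for y
    proof -
      have "1 - (2 / c) *\<^sub>R s y \<le> 0" using that c(1) by (simp add: field_simps)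
      then show ?thesis by (simp add: \<theta>_def pos_power_simps(2))
    qed
  qed
qed

text \<open>Only points of \<open>T\<close> in \<open>K\<close> acquire a neighbourhood mapped into
  \<open>T\<close>: near their chart images the cutoff is 1 and the map is \<rho>. Elsewhere
  \<open>T\<close> is merely preserved. The tolerance \<epsilon> is arbitrary for a fixed
  \<open>K\<close>, as the later composition requires.\<close>

lemma chart_near_retraction:
  fixes T U V K :: "'a::euclidean_space set" and \<phi> \<psi> :: "'a \<Rightarrow> 'a"
  assumes \<phi>: "Snu_on k U \<phi>" and \<psi>: "Snu_on k V \<psi>"
    and UV: "\<phi> ` U \<subseteq> V" "\<psi> ` V \<subseteq> U" "\<And>x. x \<in> U \<Longrightarrow> \<psi> (\<phi> x) = x"
    and \<T>: "finite \<T>" "\<And>S. S \<in> \<T> \<Longrightarrow> compact S \<and> convex S"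
    and TQ: "\<phi> ` (U \<inter> T) = V \<inter> \<Union>\<T>"
    and K: "compact K" "K \<subseteq> U" and "\<epsilon> > 0"
  shows "\<exists>N h. Snu_on k N h \<and> T \<subseteq> N \<and> h ` T \<subseteq> T \<and> (\<forall>x\<in>N. norm (h x - x) < \<epsilon>) \<and>
    (\<forall>x\<in>T \<inter> K. \<exists>W. open W \<and> x \<in> W \<and> W \<subseteq> N \<and> h ` W \<subseteq> T)"
proof -
  let ?Q = "\<Union>\<T>"
  have opU: "open U" "semialgebraic U" and opV: "open V" "semialgebraic V"
    by (rule Snu_on_domain[OF \<phi>] Snu_on_domain[OF \<psi>])+
  have cont\<phi>: "continuous_on U \<phi>" and cont\<psi>: "continuous_on V \<psi>"
    by (rule Snu_on_continuous[OF \<phi>] Snu_on_continuous[OF \<psi>])+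
  have \<psi>T: "\<psi> y \<in> T" if "y \<in> V \<inter> ?Q" for y
  proof -
    obtain x where "x \<in> U \<inter> T" "y = \<phi> x" using TQ \<open>y \<in> V \<inter> ?Q\<close> by blast
    then show ?thesis using UV(3) by simp
  qed
  have "compact (\<phi> ` K)"
    by (rule compact_continuous_image[OF continuous_on_subset[OF cont\<phi> K(2)] K(1)])
  moreover have "\<phi> ` K \<subseteq> V" using K(2) UV(1) by blast
  ultimately obtain \<theta> :: "'a \<Rightarrow> real" and C W where \<theta>: "Snu_on k UNIV \<theta>" and C: "compact C" "semialgebraic C" "C \<subseteq> V"
    and \<theta>01: "\<And>y. 0 \<le> \<theta> y \<and> \<theta> y \<le> 1" and \<theta>0: "\<And>y. y \<notin> C \<Longrightarrow> \<theta> y = 0"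
    and W: "open W" "\<phi> ` K \<subseteq> W" "\<And>y. y \<in> W \<Longrightarrow> \<theta> y = 1"
    using Snu_cutoff[OF _ opV(1)] by metis
  \<comment> \<open>A Lebesgue number \<delta> of this cover of \<open>C\<close> does two things:
    moving a point of \<open>C\<close> by less than \<delta> keeps it in \<open>V\<close>, and
    changes \<psi> by less than \<epsilon>, the diameter allowed by balls of radius
    \<epsilon>/2.\<close>
  define \<A> where "\<A> = range (\<lambda>w. {z\<in>V. \<psi> z \<in> ball w (\<epsilon> / 2)})"
  have "C \<subseteq> \<Union>\<A>"
  proof
    fix x assume "x \<in> C"
    then have "x \<in> {z\<in>V. \<psi> z \<in> ball (\<psi> x) (\<epsilon> / 2)}" using C(3) \<open>\<epsilon> > 0\<close> by auto
    then show "x \<in> \<Union>\<A>" unfolding \<A>_def by blast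
  qed
  moreover have "open A" if "A \<in> \<A>" for A
    using that Snu_on_vimage(1)[OF \<psi> open_ball semialgebraic_ball] unfolding \<A>_def by blast
  ultimately obtain \<delta> where "\<delta> > 0" and unif: "\<And>x. x \<in> C \<Longrightarrow> \<exists>A\<in>\<A>. ball x \<delta> \<subseteq> A"
    using Heine_Borel_lemma[OF C(1)] by metis
  have unifC: "y' \<in> V \<and> norm (\<psi> y' - \<psi> y) < \<epsilon>" if y: "y \<in> C" "norm (y' - y) < \<delta>" for y y'
  proof -
    obtain w where w: "ball y \<delta> \<subseteq> {z\<in>V. \<psi> z \<in> ball w (\<epsilon> / 2)}"
      using unif[OF y(1)] unfolding \<A>_def by blast
    have "y \<in> ball y \<delta>" "y' \<in> ball y \<delta>" using y(2) \<open>\<delta> > 0\<close> by (auto simp: dist_norm norm_minus_commute)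
    then have "y \<in> {z\<in>V. \<psi> z \<in> ball w (\<epsilon> / 2)}" "y' \<in> {z\<in>V. \<psi> z \<in> ball w (\<epsilon> / 2)}"
      using w by blast+
    then have "dist w (\<psi> y) < \<epsilon> / 2" "dist w (\<psi> y') < \<epsilon> / 2" "y' \<in> V" by auto
    then show ?thesis using dist_triangle_half_r[of w "\<psi> y'" \<epsilon> "\<psi> y"] by (simp add: dist_norm)
  qed
  obtain G \<rho> where \<rho>: "Snu_on k G \<rho>" and G: "?Q \<subseteq> G"
    and \<rho>G: "\<And>z. z \<in> G \<Longrightarrow> \<rho> z \<in> ?Q \<and> norm (\<rho> z - z) < \<delta>"
    and \<rho>Q: "\<And>z. z \<in> ?Q \<Longrightarrow> closed_segment z (\<rho> z) \<subseteq> ?Q"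
    using near_retraction_convex_union[OF \<T> \<open>\<delta> > 0\<close>] by metis
  have opG: "open G" "semialgebraic G" using Snu_on_domain[OF \<rho>] by blast+
  define f where "f = (\<lambda>y. y + \<theta> y *\<^sub>R (\<rho> y - y))"
  have f: "Snu_on k G f"
    unfolding f_def
    by (intro Snu_on_add Snu_on_diff Snu_on_scaleR \<rho> Snu_on_id opG Snu_on_subset[OF \<theta>]) auto
  have f_id: "f y = y" if "y \<notin> C" for y using \<theta>0[OF that] by (simp add: f_def)
  have f_near: "norm (f y - y) < \<delta>" if "y \<in> G" for y
  proof -
    have "norm (f y - y) = \<theta> y * norm (\<rho> y - y)" using \<theta>01[of y] by (simp add: f_def)
    also have "\<dots> \<le> norm (\<rho> y - y)" using \<theta>01[of y] by (simp add: mult_left_le_one_le)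
    finally show ?thesis using \<rho>G[OF that] by simp
  qed
  \<comment> \<open>Off \<open>C\<close> the map \<open>f\<close> is the identity, so the estimate
    on the compact set \<open>C\<close> suffices for all of \<open>V\<close>.\<close>
  have fV: "f y \<in> V \<and> norm (\<psi> (f y) - \<psi> y) < \<epsilon>" if "y \<in> G" "y \<in> V" for y
    using that unifC[OF _ f_near[OF that(1)]] f_id[of y] \<open>\<epsilon> > 0\<close> by (cases "y \<in> C") auto
  have fQ: "f y \<in> ?Q" if "y \<in> ?Q" for y
  proof -
    have "f y = (1 - \<theta> y) *\<^sub>R y + \<theta> y *\<^sub>R \<rho> y" by (simp add: f_def algebra_simps)
    then have "f y \<in> closed_segment y (\<rho> y)" using \<theta>01[of y] by (auto simp: closed_segment_def)
    then show ?thesis using \<rho>Q[OF that] by blast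
  qed
  define N1 where "N1 = {x\<in>U. \<phi> x \<in> G}"
  \<comment> \<open>The identity takes over here. On the overlap with \<open>N1\<close> the two
    definitions agree, because \<phi> x lies outside \<open>C\<close> and \<open>f\<close> fixes it.
    Together the two sets cover \<open>T\<close>: points in \<open>U\<close> go into the polyhedron
    and hence into \<open>G\<close>, and points outside \<open>U\<close> miss \<psi>(C).\<close>
  define N2 where "N2 = - \<psi> ` C"
  define h where "h = (\<lambda>x. if x \<in> N1 then \<psi> (f (\<phi> x)) else x)"
  have N1: "open N1" "semialgebraic N1" unfolding N1_def using Snu_on_vimage[OF \<phi> opG] by blast+
  have "compact (\<psi> ` C)"
    by (rule compact_continuous_image[OF continuous_on_subset[OF cont\<psi> C(3)] C(1)])
  moreover have "semialgebraic (\<psi> ` C)"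
    using semialgebraic_map_on_image semialgebraic_map_on_subset[OF _ C(2,3)] \<psi>
    unfolding Snu_on_def by blast
  ultimately have N2: "open N2" "semialgebraic N2"
    unfolding N2_def by (auto intro: semialgebraic.compl compact_imp_closed)
  have h1: "h x = \<psi> (f (\<phi> x))" if "x \<in> N1" for x using that by (simp add: h_def)
  have h2: "h x = x" if "x \<in> N2" for x
  proof (cases "x \<in> N1")
    case True
    then have "\<psi> (\<phi> x) = x" using UV(3) by (simp add: N1_def)
    moreover from this have "\<phi> x \<notin> C" using that by (force simp: N2_def)
    ultimately show ?thesis using f_id True by (simp add: h_def)
  qed (simp add: h_def)
  have N1V: "\<phi> x \<in> G" "\<phi> x \<in> V" "\<psi> (\<phi> x) = x" if "x \<in> N1" for x
    using that UV by (auto simp: N1_def)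
  have "Snu_on k N1 \<phi>" by (rule Snu_on_subset[OF \<phi> N1]) (auto simp: N1_def)
  then have "Snu_on k N1 (\<lambda>x. f (\<phi> x))" by (rule Snu_on_compose[OF _ f]) (use N1V in blast)
  then have "Snu_on k N1 (\<lambda>x. \<psi> (f (\<phi> x)))" by (rule Snu_on_compose[OF _ \<psi>]) (use fV N1V in blast)
  then have "Snu_on k N1 h" by (rule Snu_on_cong) (simp add: h1)
  moreover have "Snu_on k N2 h" by (rule Snu_on_cong[OF Snu_on_id[OF N2]]) (simp add: h2)
  ultimately have h: "Snu_on k (N1 \<union> N2) h" by (rule Snu_on_Un)
  have TU: "\<phi> x \<in> V \<inter> ?Q" if "x \<in> T" "x \<in> U" for x using that TQ by blast
  have TN: "x \<in> N1 \<union> N2" if "x \<in> T" for x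
  proof (cases "x \<in> U")
    case True
    then show ?thesis using TU[OF that True] G by (auto simp: N1_def)
  next
    case False
    then show ?thesis using C(3) UV(2) by (auto simp: N2_def)
  qed
  have hT: "h x \<in> T" if "x \<in> T" for x
  proof (cases "x \<in> N1")
    case True
    then have "\<phi> x \<in> V \<inter> ?Q" using TU that by (auto simp: N1_def)
    then have "f (\<phi> x) \<in> V \<inter> ?Q" using fQ fV N1V[OF True] by blast
    then show ?thesis using \<psi>T h1[OF True] by simp
  qed (use that in \<open>simp add: h_def\<close>)
  have near: "norm (h x - x) < \<epsilon>" if "x \<in> N1 \<union> N2" for x
    using that fV[of "\<phi> x"] N1V[of x] h1[of x] h2[of x] \<open>\<epsilon> > 0\<close> by (cases "x \<in> N1") auto
  have loc: "\<exists>W. open W \<and> x \<in> W \<and> W \<subseteq> N1 \<union> N2 \<and> h ` W \<subseteq> T" if x: "x \<in> T \<inter> K" for x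
  proof (intro exI[of _ "N1 \<inter> \<phi> -` W"] conjI)
    have "open (\<phi> -` W \<inter> N1)"
      using continuous_on_open_vimage[OF N1(1)] W(1) continuous_on_subset[OF cont\<phi>, of N1]
      by (auto simp: N1_def)
    then show "open (N1 \<inter> \<phi> -` W)" by (simp add: Int_commute)
    have "x \<in> U" using x K(2) by blast
    then show "x \<in> N1 \<inter> \<phi> -` W" using x TU[of x] G W(2) by (auto simp: N1_def)
    show "h ` (N1 \<inter> \<phi> -` W) \<subseteq> T"
    proof clarify
      fix z assume z: "z \<in> N1" "\<phi> z \<in> W"
      then have "f (\<phi> z) = \<rho> (\<phi> z)" using W(3) by (simp add: f_def)
      then have "f (\<phi> z) \<in> V \<inter> ?Q" using fV N1V[OF z(1)] \<rho>G by force
      then show "h z \<in> T" using \<psi>T h1[OF z(1)] by simp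
    qed
  qed auto
  show ?thesis
    using h TN hT near loc by (intro exI[of _ "N1 \<union> N2"] exI[of _ h]) auto
qed

text \<open>In \<open>loc\<close> the radius is fixed before \<epsilon>. The displacement of the
  earlier maps can thus be made small compared with the radius of the next ball, so a point of the
  half-radius ball is still in the full ball when its own map acts.\<close>

lemma global_near_retraction:
  fixes T :: "'a::euclidean_space set"
  assumes "compact T" and "\<epsilon> > 0"
    and loc: "\<And>x. x \<in> T \<Longrightarrow> \<exists>r>0. \<forall>\<epsilon>>0. \<exists>N h. Snu_on k N h \<and> T \<subseteq> N \<and> h ` T \<subseteq> T \<and>
      (\<forall>y\<in>N. norm (h y - y) < \<epsilon>) \<and>
      (\<forall>y\<in>T \<inter> cball x r. \<exists>W. open W \<and> y \<in> W \<and> W \<subseteq> N \<and> h ` W \<subseteq> T)"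
  obtains W h where "Snu_on k W h" "T \<subseteq> W" "h ` W \<subseteq> T" "\<And>y. y \<in> W \<Longrightarrow> norm (h y - y) < \<epsilon>"
proof -
  obtain r where r: "\<And>x. x \<in> T \<Longrightarrow> r x > 0"
    and h: "\<And>x \<epsilon>. x \<in> T \<Longrightarrow> \<epsilon> > 0 \<Longrightarrow> \<exists>N h. Snu_on k N h \<and> T \<subseteq> N \<and> h ` T \<subseteq> T \<and>
      (\<forall>y\<in>N. norm (h y - y) < \<epsilon>) \<and>
      (\<forall>y\<in>T \<inter> cball x (r x). \<exists>W. open W \<and> y \<in> W \<and> W \<subseteq> N \<and> h ` W \<subseteq> T)"
    using loc by metis
  obtain X where X: "X \<subseteq> T" "finite X" "T \<subseteq> (\<Union>x\<in>X. ball x (r x / 2))"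
    using compactE_image[OF assms(1), of T "\<lambda>x. ball x (r x / 2)"] r by force
  have "\<exists>N h. Snu_on k N h \<and> T \<subseteq> N \<and> h ` T \<subseteq> T \<and> (\<forall>y\<in>N. norm (h y - y) < \<epsilon>) \<and>
      (\<forall>x\<in>I. \<forall>y\<in>T \<inter> ball x (r x / 2). \<exists>W. open W \<and> y \<in> W \<and> W \<subseteq> N \<and> h ` W \<subseteq> T)"
    if "finite I" "I \<subseteq> T" "\<epsilon> > 0" for I \<epsilon>
    using that
  proof (induction I arbitrary: \<epsilon> rule: finite_induct)
    case empty
    have "Snu_on k UNIV (\<lambda>x::'a. x)" by (simp add: Snu_on_id semialgebraic_UNIV)
    then show ?case using empty by (intro exI[of _ UNIV] exI[of _ "\<lambda>x. x"]) auto
  next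
    case (insert j I)
    have j: "j \<in> T" using insert.prems by simp
    \<comment> \<open>The bound \<epsilon>/2 is this map's share of the total displacement; r j / 2
      keeps points of the half-radius ball around \<open>j\<close> inside the closed ball on which
      \<open>h2\<close> works.\<close>
    have \<epsilon>': "min (\<epsilon> / 2) (r j / 2) > 0" using r[OF j] insert.prems by simp
    obtain N1 h1 where h1: "Snu_on k N1 h1" "T \<subseteq> N1" "h1 ` T \<subseteq> T"
      "\<And>y. y \<in> N1 \<Longrightarrow> norm (h1 y - y) < min (\<epsilon> / 2) (r j / 2)"
      "\<And>x y. x \<in> I \<Longrightarrow> y \<in> T \<inter> ball x (r x / 2) \<Longrightarrow> \<exists>W. open W \<and> y \<in> W \<and> W \<subseteq> N1 \<and> h1 ` W \<subseteq> T"
      using insert.IH[OF _ \<epsilon>'] insert.prems by auto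
    obtain N2 h2 where h2: "Snu_on k N2 h2" "T \<subseteq> N2" "h2 ` T \<subseteq> T"
      "\<And>y. y \<in> N2 \<Longrightarrow> norm (h2 y - y) < \<epsilon> / 2"
      "\<And>y. y \<in> T \<inter> cball j (r j) \<Longrightarrow> \<exists>W. open W \<and> y \<in> W \<and> W \<subseteq> N2 \<and> h2 ` W \<subseteq> T"
      using h[OF j, of "\<epsilon> / 2"] insert.prems by auto
    define N where "N = {x\<in>N1. h1 x \<in> N2}"
    have N: "open N" "semialgebraic N"
      unfolding N_def by (rule Snu_on_vimage[OF h1(1) Snu_on_domain[OF h2(1)]])+
    have vimage: "open (N1 \<inter> h1 -` A)" if "open A" for A
      using continuous_on_open_vimage[OF Snu_on_domain(1)[OF h1(1)]] Snu_on_continuous[OF h1(1)] that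
      by (metis Int_commute)
    have "Snu_on k N h1" by (rule Snu_on_subset[OF h1(1) N]) (auto simp: N_def)
    then have "Snu_on k N (\<lambda>x. h2 (h1 x))"
      by (rule Snu_on_compose[OF _ h2(1)]) (auto simp: N_def)
    moreover have "T \<subseteq> N" using h1(2,3) h2(2) by (auto simp: N_def)
    moreover have "(\<lambda>x. h2 (h1 x)) ` T \<subseteq> T" using h1(3) h2(3) by auto
    moreover have "norm (h2 (h1 y) - y) < \<epsilon>" if "y \<in> N" for y
    proof -
      have "norm (h1 y - y) < \<epsilon> / 2" "norm (h2 (h1 y) - h1 y) < \<epsilon> / 2"
        using that h1(4)[of y] h2(4)[of "h1 y"] by (auto simp: N_def)
      then show ?thesis using norm_triangle_lt[of "h2 (h1 y) - h1 y" "h1 y - y" \<epsilon>] by simp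
    qed
    moreover have "\<exists>W. open W \<and> y \<in> W \<and> W \<subseteq> N \<and> (\<lambda>x. h2 (h1 x)) ` W \<subseteq> T"
      if x: "x \<in> insert j I" and y: "y \<in> T \<inter> ball x (r x / 2)" for x y
    proof (cases "x \<in> I")
      case True
      then obtain W where W: "open W" "y \<in> W" "W \<subseteq> N1" "h1 ` W \<subseteq> T" using h1(5) y by blast
      \<comment> \<open>\<open>W\<close> is already mapped into \<open>T\<close>, where
        \<open>h2\<close> is defined and which \<open>h2\<close> preserves.\<close>
      then have "W \<subseteq> N" using h2(2) by (auto simp: N_def)
      moreover have "(\<lambda>x. h2 (h1 x)) ` W \<subseteq> T" using W(4) h2(3) by auto
      ultimately show ?thesis using W by blast
    next
      case False
      then have xj: "x = j" using x by simp
      have yT: "y \<in> T" and yN: "y \<in> N1" using y h1(2) by auto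
      have "norm (h1 y - y) < r j / 2" using h1(4)[OF yN] by simp
      moreover have "dist j y < r j / 2" using y xj by simp
      ultimately have "dist j (h1 y) < r j"
        using dist_triangle_half_r[of y j "r j" "h1 y"] by (simp add: dist_norm norm_minus_commute)
      then have "h1 y \<in> T \<inter> cball j (r j)" using h1(3) yT by auto
      from h2(5)[OF this] obtain W where W: "open W" "h1 y \<in> W" "W \<subseteq> N2" "h2 ` W \<subseteq> T" by blast
      show ?thesis
        by (rule exI[of _ "N1 \<inter> h1 -` W"]) (use vimage[OF W(1)] W yN in \<open>auto simp: N_def\<close>)
    qed
    ultimately have "Snu_on k N (\<lambda>x. h2 (h1 x)) \<and> T \<subseteq> N \<and> (\<lambda>x. h2 (h1 x)) ` T \<subseteq> T \<and>
      (\<forall>y\<in>N. norm (h2 (h1 y) - y) < \<epsilon>) \<and> (\<forall>x\<in>insert j I. \<forall>y\<in>T \<inter> ball x (r x / 2).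
        \<exists>W. open W \<and> y \<in> W \<and> W \<subseteq> N \<and> (\<lambda>x. h2 (h1 x)) ` W \<subseteq> T)"
      by (intro conjI ballI)
    then show ?case by (intro exI)
  qed
  from this[OF X(2,1) \<open>\<epsilon> > 0\<close>]
  obtain N h where Nh: "Snu_on k N h" "\<And>y. y \<in> N \<Longrightarrow> norm (h y - y) < \<epsilon>"
    and "\<And>x y. x \<in> X \<Longrightarrow> y \<in> T \<inter> ball x (r x / 2) \<Longrightarrow> \<exists>W. open W \<and> y \<in> W \<and> W \<subseteq> N \<and> h ` W \<subseteq> T"
    by blast
  with X(3) have "\<exists>W. open W \<and> y \<in> W \<and> W \<subseteq> N \<and> h ` W \<subseteq> T" if "y \<in> T" for y
    using that by blast
  then obtain W where W: "\<And>y. y \<in> T \<Longrightarrow> open (W y) \<and> y \<in> W y \<and> W y \<subseteq> N \<and> h ` W y \<subseteq> T" by metis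
  have "open (\<Union>y\<in>T. W y)" "T \<subseteq> (\<Union>y\<in>T. W y)" using W by auto
  then obtain G where G: "open G" "semialgebraic G" "T \<subseteq> G" "G \<subseteq> (\<Union>y\<in>T. W y)"
    using compact_semialgebraic_nbhd[OF assms(1)] by metis
  have GN: "G \<subseteq> N" using G(4) W by blast
  show thesis
  proof
    show "Snu_on k G h" by (rule Snu_on_subset[OF Nh(1) G(1,2) GN])
    show "h ` G \<subseteq> T" using G(4) W by blast
    show "norm (h y - y) < \<epsilon>" if "y \<in> G" for y using Nh(2) GN that by blast
  qed (rule G(3))
qed

section \<open>Passage to maps between semialgebraic sets, and density\<close>

lemma Snu_function_imp_Snu_on:
  assumes "Snu_function k U f" "open U" "semialgebraic U"
  shows "Snu_on k U f"
proof -
  obtain U' F where "open U'" "U \<subseteq> U'" "Snu_open k U' F" "\<And>x. x \<in> U \<Longrightarrow> F x = f x"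
    using assms(1) by (auto simp: Snu_function_def)
  then show ?thesis
    using Snu_on_subset[of k U' F U] Snu_on_cong[of k U F f] assms(2,3) by (simp add: Snu_open_iff)
qed

lemma Snu_map_imp_Snu_on:
  fixes f :: "real^'m \<Rightarrow> real^'n"
  assumes "Snu_map k U V f" "open U" "semialgebraic U"
  shows "Snu_on k U f"
proof (rule Snu_on_componentwise[OF assms(2)])
  fix b :: "real^'n" assume "b \<in> Basis"
  then obtain i where "b = axis i 1" by (auto simp: Basis_vec_def)
  then have "(\<lambda>x. f x \<bullet> b) = (\<lambda>x. f x $ i)" by (simp add: cart_eq_inner_axis)
  then show "Snu_on k U (\<lambda>x. f x \<bullet> b)"
    using assms by (simp add: Snu_map_def Snu_function_imp_Snu_on)
qed

lemma Snu_on_imp_Snu_map: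
  fixes f :: "real^'m \<Rightarrow> real^'n"
  assumes "Snu_on k U f" "S \<subseteq> U" "f ` S \<subseteq> T" "\<And>x. x \<in> S \<Longrightarrow> g x = f x"
  shows "Snu_map k S T g"
  unfolding Snu_map_def
proof (intro conjI allI)
  show "g \<in> S \<rightarrow> T" using assms(3,4) by auto
  fix i
  have "Snu_on k U (\<lambda>x. f x \<bullet> axis i 1)"
    by (intro Snu_on_polynomial_compose[OF assms(1)] polynomial_function_rules)
  then have "Snu_open k U (\<lambda>x. f x $ i)"
    using Snu_on_domain(1)[OF assms(1)] by (simp add: Snu_open_iff cart_eq_inner_axis)
  then show "Snu_function k S (\<lambda>x. g x $ i)"
    unfolding Snu_function_def using Snu_on_domain[OF assms(1)] assms(2,4)
    by (intro exI[of _ U] exI[of _ "\<lambda>x. f x $ i"]) auto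
qed

text \<open>The extensions of the components have semialgebraic graphs over larger open sets;
  semialgebraicity of \<open>S\<close> permits restricting them to \<open>S\<close>.\<close>

lemma Snu_maps_subset_S0_maps:
  fixes S :: "(real^'m) set" and T :: "(real^'n) set"
  assumes "semialgebraic S"
  shows "Snu_maps k S T \<subseteq> S0_maps S T"
proof
  fix f assume f: "f \<in> Snu_maps k S T"
  have comp: "continuous_on S (\<lambda>x. f x $ i) \<and> semialgebraic_map_on S (\<lambda>x. f x $ i)" for i
  proof -
    have "Snu_function k S (\<lambda>x. f x $ i)" using f by (simp add: Snu_maps_def Snu_map_def)
    then obtain U F where U: "open U" "S \<subseteq> U" "Snu_on k U F" "\<And>x. x \<in> S \<Longrightarrow> F x = f x $ i"
      by (auto simp: Snu_function_def Snu_open_iff)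
    have "continuous_on S F" using Snu_on_continuous[OF U(3)] U(2) continuous_on_subset by blast
    moreover have "semialgebraic_map_on S F"
      by (rule semialgebraic_map_on_subset[OF _ assms U(2)]) (use U(3) in \<open>simp add: Snu_on_def\<close>)
    ultimately show ?thesis
      using U(4) continuous_on_cong[of S S F "\<lambda>x. f x $ i"] semialgebraic_map_on_cong[of S F] by simp
  qed
  have "continuous_on S (\<lambda>x. \<chi> i. f x $ i)" using comp by (intro continuous_on_vec_lambda) blast
  then have "continuous_on S f" by simp
  moreover have "semialgebraic_map_on S f"
  proof (rule semialgebraic_map_on_componentwise)
    fix b :: "real^'n" assume "b \<in> Basis"
    then obtain i where "b = axis i 1" by (auto simp: Basis_vec_def)
    then have "(\<lambda>x. f x \<bullet> b) = (\<lambda>x. f x $ i)" by (simp add: cart_eq_inner_axis)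
    then show "semialgebraic_map_on S (\<lambda>x. f x \<bullet> b)" using comp by simp
  qed
  ultimately show "f \<in> S0_maps S T"
    using f by (auto simp: S0_maps_def Snu_maps_def Snu_map_def PiE_def)
qed

lemma Snu_approximation:
  fixes S :: "(real^'m) set" and T :: "(real^'n) set"
  assumes "compact S" "compact T" "locally_Snu_polyhedral k T"
    and f: "continuous_on S f" "f ` S \<subseteq> T" and "\<epsilon> > 0"
  obtains g where "g \<in> Snu_maps k S T" "\<And>x. x \<in> S \<Longrightarrow> dist (f x) (g x) < \<epsilon>"
proof -
  have loc: "\<exists>r>0. \<forall>\<epsilon>>0. \<exists>N h. Snu_on k N h \<and> T \<subseteq> N \<and> h ` T \<subseteq> T \<and> (\<forall>y\<in>N. norm (h y - y) < \<epsilon>) \<and>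
      (\<forall>y\<in>T \<inter> cball x r. \<exists>W. open W \<and> y \<in> W \<and> W \<subseteq> N \<and> h ` W \<subseteq> T)" if "x \<in> T" for x
  proof -
    obtain U V \<phi> Q where U: "open U" "semialgebraic U" "x \<in> U" and V: "open V" "semialgebraic V" "x \<in> V"
      and \<phi>: "Snu_diffeomorphism k U V \<phi>" and Q: "compact_polyhedron Q" "\<phi> ` (U \<inter> T) = V \<inter> Q"
      using bspec[OF assms(3)[unfolded locally_Snu_polyhedral_def] \<open>x \<in> T\<close>]
      by (elim exE conjE) (rule that)
    obtain \<K> where \<K>: "simplicial_complex \<K>" "Q = \<Union>\<K>" using Q(1) by (auto simp: compact_polyhedron_def)
    have fin: "finite \<K>" "\<And>K. K \<in> \<K> \<Longrightarrow> compact K \<and> convex K"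
      using \<K>(1) by (auto simp: simplicial_complex_def dest: compact_simplex convex_simplex)
    \<comment> \<open>The radius depends on the chart alone, as the order of quantifiers in
      \<open>global_near_retraction\<close> demands.\<close>
    obtain r where r: "r > 0" "cball x r \<subseteq> U" using U open_contains_cball by blast
    define \<psi> where "\<psi> = inv_into U \<phi>"
    have bij: "bij_betw \<phi> U V" and "Snu_on k U \<phi>" "Snu_on k V \<psi>"
      using \<phi> U V by (auto simp: Snu_diffeomorphism_def \<psi>_def intro: Snu_map_imp_Snu_on)
    moreover have "\<phi> ` U \<subseteq> V" "\<psi> ` V \<subseteq> U" "\<And>x. x \<in> U \<Longrightarrow> \<psi> (\<phi> x) = x"
      using bij by (auto simp: \<psi>_def bij_betw_def inv_into_into)
    ultimately have "\<exists>N h. Snu_on k N h \<and> T \<subseteq> N \<and> h ` T \<subseteq> T \<and> (\<forall>y\<in>N. norm (h y - y) < \<epsilon>) \<and>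
      (\<forall>y\<in>T \<inter> cball x r. \<exists>W. open W \<and> y \<in> W \<and> W \<subseteq> N \<and> h ` W \<subseteq> T)" if "\<epsilon> > 0" for \<epsilon>
      using chart_near_retraction[of k U \<phi> V \<psi> \<K> T "cball x r" \<epsilon>] fin Q(2) \<K>(2) r that by simp
    then show ?thesis using r(1) by blast
  qed
  have "\<epsilon> / 2 > 0" using \<open>\<epsilon> > 0\<close> by simp
  then obtain W h where h: "Snu_on k W h" "T \<subseteq> W" "h ` W \<subseteq> T" "\<And>y. y \<in> W \<Longrightarrow> norm (h y - y) < \<epsilon> / 2"
    using global_near_retraction[OF assms(2) _ loc] by metis
  have W: "open W" "semialgebraic W" using Snu_on_domain[OF h(1)] by auto
  have fS: "compact (f ` S)" using compact_continuous_image[OF f(1) assms(1)] .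
  obtain \<delta> where \<delta>: "\<delta> > 0" "(\<Union>y\<in>f ` S. ball y \<delta>) \<subseteq> W"
    using compact_subset_open_imp_ball_epsilon_subset[OF fS W(1)] f(2) h(2) by blast
  \<comment> \<open>Closeness \<delta> places the values of \<open>p\<close> on \<open>S\<close> in
    the domain \<open>W\<close> of \<open>h\<close>; the remaining \<epsilon>/2 is shared with the
    displacement of \<open>h\<close>.\<close>
  obtain p where p: "polynomial_function p" "\<And>x. x \<in> S \<Longrightarrow> norm (f x - p x) < min \<delta> (\<epsilon> / 2)"
    using Stone_Weierstrass_polynomial_function[OF assms(1) f(1), of "min \<delta> (\<epsilon> / 2)"] \<delta>(1) \<open>\<epsilon> > 0\<close> by auto
  have pW: "p x \<in> W" if "x \<in> S" for x
  proof -
    have "p x \<in> ball (f x) \<delta>" using p(2)[OF that] by (simp add: dist_norm)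
    then show ?thesis using \<delta>(2) that by blast
  qed
  define N where "N = {x\<in>UNIV. p x \<in> W}"
  have N: "open N" "semialgebraic N"
    unfolding N_def by (rule Snu_on_vimage[OF Snu_on_polynomial[OF p(1)] W])+
  have "Snu_on k N p" by (rule Snu_on_subset[OF Snu_on_polynomial[OF p(1)] N]) simp
  then have hp: "Snu_on k N (\<lambda>x. h (p x))" by (rule Snu_on_compose[OF _ h(1)]) (auto simp: N_def)
  define g where "g = restrict (\<lambda>x. h (p x)) S"
  show thesis
  proof
    have "Snu_map k S T g"
      by (rule Snu_on_imp_Snu_map[OF hp]) (use pW h(3) in \<open>auto simp: N_def g_def\<close>)
    then show "g \<in> Snu_maps k S T" by (simp add: Snu_maps_def g_def)
    show "dist (f x) (g x) < \<epsilon>" if "x \<in> S" for x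
    proof -
      have "dist (p x) (f x) < \<epsilon> / 2" "dist (p x) (h (p x)) < \<epsilon> / 2"
        using p(2)[OF that] h(4)[OF pW[OF that]] by (simp_all add: dist_norm norm_minus_commute)
      then show ?thesis using dist_triangle_half_r[of "p x" "f x" \<epsilon> "h (p x)"] that by (simp add: g_def)
    qed
  qed
qed

text \<open>\<open>funspace\<close> consists of bounded maps; compactness of \<open>S\<close>
  ensures that the intersection in \<open>submetric\<close> removes none of the continuous
  ones.\<close>

lemma S0_maps_subset_fspace:
  assumes "compact S"
  shows "S0_maps S T \<subseteq> mspace (funspace S euclidean_metric)"
proof
  fix f assume f: "f \<in> S0_maps S T"
  then have "bounded (f ` S)"
    using assms by (auto simp: S0_maps_def intro: compact_imp_bounded compact_continuous_image)
  then show "f \<in> mspace (funspace S euclidean_metric)"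
    using f by (auto simp: S0_maps_def Met_TC.fspace_def PiE_def)
qed

theorem theorem7:
  fixes S :: "(real^'m) set" and T :: "(real^'n) set" and \<nu> :: nat
  assumes "compact S" and "semialgebraic S"
    and "compact T" and "semialgebraic T"
    and "\<nu> \<ge> 1"
    and "locally_Snu_polyhedral \<nu> T"
  shows "Snu_maps \<nu> S T \<subseteq> S0_maps S T \<and>
         S0_topology S T closure_of Snu_maps \<nu> S T = S0_maps S T"
proof (intro conjI)
  show sub: "Snu_maps \<nu> S T \<subseteq> S0_maps S T" by (rule Snu_maps_subset_S0_maps[OF assms(2)])
  define m where "m = submetric (funspace S euclidean_metric) (S0_maps S T)"
  interpret M: Metric_space "mspace m" "mdist m" by (rule Metric_space_mspace_mdist)
  have sp: "mspace m = S0_maps S T"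
    using S0_maps_subset_fspace[OF assms(1), of T] by (simp add: m_def Int_absorb2)
  \<comment> \<open>Closed balls are used because strict pointwise inequalities bound a supremum
    only weakly; they describe the closure equally well.\<close>
  have "\<exists>g\<in>Snu_maps \<nu> S T. g \<in> M.mcball f \<epsilon>" if f: "f \<in> S0_maps S T" and "\<epsilon> > 0" for f \<epsilon>
  proof -
    have "continuous_on S f" "f ` S \<subseteq> T" using f by (auto simp: S0_maps_def)
    from Snu_approximation[OF assms(1,3,6) this \<open>\<epsilon> > 0\<close>]
    obtain g where g: "g \<in> Snu_maps \<nu> S T" "\<And>x. x \<in> S \<Longrightarrow> dist (f x) (g x) < \<epsilon>" by blast
    have "f \<in> mspace (funspace S euclidean_metric)" "g \<in> mspace (funspace S euclidean_metric)"
      using S0_maps_subset_fspace[OF assms(1)] f g(1) sub by blast+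
    then have "mdist m f g \<le> \<epsilon>"
    proof (cases "S = {}")
      case True
      then show ?thesis using \<open>\<epsilon> > 0\<close> by (simp add: m_def)
    next
      case False
      then show ?thesis
        using funspace_mdist_le[of f S euclidean_metric g \<epsilon>] \<open>f \<in> mspace _\<close> \<open>g \<in> mspace _\<close> g(2)
        by (simp add: m_def less_imp_le)
    qed
    moreover have "f \<in> mspace m" "g \<in> mspace m" unfolding sp using f g(1) sub by blast+
    ultimately have "g \<in> M.mcball f \<epsilon>" by (simp only: M.in_mcball)
    then show ?thesis using g(1) by blast
  qed
  then have "M.mtopology closure_of Snu_maps \<nu> S T = mspace m"
    unfolding M.metric_closure_of_alt unfolding sp by blast
  then show "S0_topology S T closure_of Snu_maps \<nu> S T = S0_maps S T"
    unfolding S0_topology_def m_def[symmetric] mtopology_of_def sp .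
qed

end
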